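(* There is an algorithm that, given $N$ processes $P_1,\ldots,P_N$ of total size $n$ (the sum of the lengths of the lists), computes the optimal space $\mathrm{spmin}(P_1,\ldots,P_N)$ and an optimal schedule, i.e. an interleaving $S$ of $P_1,\ldots,P_N$ with $\mathrm{sps}(S)=\mathrm{spmin}(P_1,\ldots,P_N)$, in time $O(N\log N+n\log N)$.
   Context: A process is a nonempty finite list of non-negative integers. Let $P_i=[p_{i,1},\ldots,p_{i,m_i}]$, $i=1,\ldots,N$, be processes. An interleaving (schedule) of $P_1,\ldots,P_N$ is a list $[q_1,\ldots,q_h]$ of $N$-tuples for which there are index tuples $s_1,\ldots,s_h$ with $s_1=(1,\ldots,1)$, $s_h=(m_1,\ldots,m_N)$, for each $t<h$: $s_{t+1}\neq s_t$ and $s_{t+1,i}\in\{s_{t,i},s_{t,i}+1\}$ for all $i$, and $q_t=(p_{1,s_{t,1}},\ldots,p_{N,s_{t,N}})$. (Each process proceeds by at most one step at a time, at least one process proceeds, and a finished process stays at its last element.) The space usage $\mathrm{sps}(S)$ of an interleaving $S$ is the maximum over the tuples in $S$ of the sum of the entries of the tuple. $\mathrm{spmin}(P_1,\ldots,P_N)$ is the minimum of $\mathrm{sps}(S)$ over all interleavings $S$ of $P_1,\ldots,P_N$. Cost model: additions, subtractions, comparisons and maxima of integers count as single steps. A schedule is output in the form of the sequence of sets of process indices that proceed in each step. For $N=1$, $\log N$ is read as $1$. *)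

theory Defs
  imports Complex_Main
begin

section \<open>Processes and interleavings\<close>

text \<open>
  The processes \<open>P\<^sub>1, \<dots>, P\<^sub>N\<close> are given as a list of lists of natural numbers. Process
  indices and positions inside a process are counted from 0.
\<close>

type_synonym process = "nat list"

definition processes :: "process list \<Rightarrow> bool" where
  "processes Ps \<longleftrightarrow> Ps \<noteq> [] \<and> (\<forall>P\<in>set Ps. P \<noteq> [])"

definition total_size :: "process list \<Rightarrow> nat" where
  "total_size Ps = (\<Sum>P\<leftarrow>Ps. length P)"

definition index_step :: "nat list \<Rightarrow> nat list \<Rightarrow> bool" where
  "index_step s s' \<longleftrightarrow> length s' = length s \<and> s' \<noteq> s \<and>
     (\<forall>i<length s. s' ! i = s ! i \<or> s' ! i = s ! i + 1)"

definition index_tuples :: "process list \<Rightarrow> nat list list \<Rightarrow> bool" where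
  "index_tuples Ps ss \<longleftrightarrow> ss \<noteq> [] \<and>
     hd ss = replicate (length Ps) 0 \<and>
     last ss = map (\<lambda>P. length P - 1) Ps \<and>
     (\<forall>t. t + 1 < length ss \<longrightarrow> index_step (ss ! t) (ss ! (t + 1)))"

definition entries :: "process list \<Rightarrow> nat list \<Rightarrow> nat list" where
  "entries Ps s = map (\<lambda>i. Ps ! i ! (s ! i)) [0..<length Ps]"

definition interleaving :: "process list \<Rightarrow> nat list list \<Rightarrow> bool" where
  "interleaving Ps S \<longleftrightarrow> (\<exists>ss. index_tuples Ps ss \<and> S = map (entries Ps) ss)"

definition sps :: "nat list list \<Rightarrow> nat" where
  "sps S = Max (sum_list ` set S)"

definition spmin :: "process list \<Rightarrow> nat" where
  "spmin Ps = (LEAST k. \<exists>S. interleaving Ps S \<and> sps S = k)"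

text \<open>
  The interleaving \<open>S\<close> is given by the sequence \<open>Ds\<close> of the sets of processes that proceed
  in each step; every set is represented by a list without repetitions.
\<close>

definition given_by_moves :: "process list \<Rightarrow> nat list list \<Rightarrow> nat list list \<Rightarrow> bool" where
  "given_by_moves Ps S Ds \<longleftrightarrow>
     (\<exists>ss. index_tuples Ps ss \<and> S = map (entries Ps) ss \<and>
           length ss = length Ds + 1 \<and>
           (\<forall>t<length Ds. distinct (Ds ! t) \<and>
              set (Ds ! t) = {i. i < length Ps \<and> ss ! (t + 1) ! i = ss ! t ! i + 1}))"

text \<open>The convention that \<open>log N\<close> is read as 1 for \<open>N = 1\<close>.\<close>

definition log_of :: "nat \<Rightarrow> real" where
  "log_of N = (if N = 1 then 1 else log 2 (real N))"


section \<open>Algorithms and their running time\<close>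

text \<open>
  An algorithm is a program of a first-order, call-by-value language over integers and
  immutable lists, and its running time is the number of evaluated expression nodes. Every
  evaluation step is a constant-time operation of a unit-cost random access machine: lists
  are singly linked cells and are passed by reference, there is no structural comparison and
  no multiplication, and the number of variables in scope is bounded in terms of the program
  text. Hence time bounds for this language also hold, up to a constant factor, for such a
  machine.

  Variables are de Bruijn indices into the environment. \<open>ELet\<close> binds one variable; the second
  branch of \<open>ECase\<close> binds the head (index 0) and the tail (index 1) of the list. A program
  is a list of function bodies, evaluated in the environment consisting of the arguments of
  the call; execution starts with function 0.
\<close>

datatype val = IntV int | ListV "val list"

datatype arith = Add | Sub | Maximum

datatype comparison = Less | LessEq | Equal

datatype exp =
    EVar nat
  | EInt int
  | ENil
  | ECons exp exp
  | EArith arith exp exp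
  | EIf comparison exp exp exp exp
  | ECase exp exp exp
  | ELet exp exp
  | ECall nat "exp list"

type_synonym program = "exp list"

fun arith_op :: "arith \<Rightarrow> int \<Rightarrow> int \<Rightarrow> int" where
  "arith_op Add a b = a + b"
| "arith_op Sub a b = a - b"
| "arith_op Maximum a b = max a b"

fun compare_op :: "comparison \<Rightarrow> int \<Rightarrow> int \<Rightarrow> bool" where
  "compare_op Less a b = (a < b)"
| "compare_op LessEq a b = (a \<le> b)"
| "compare_op Equal a b = (a = b)"

text \<open>
  \<open>eval p \<Gamma> e v t\<close>: in environment \<open>\<Gamma>\<close>, expression \<open>e\<close> evaluates to \<open>v\<close> in \<open>t\<close> steps.
\<close>

inductive eval :: "program \<Rightarrow> val list \<Rightarrow> exp \<Rightarrow> val \<Rightarrow> nat \<Rightarrow> bool"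
  and evals :: "program \<Rightarrow> val list \<Rightarrow> exp list \<Rightarrow> val list \<Rightarrow> nat \<Rightarrow> bool"
  for p :: program
where
  Var: "i < length \<Gamma> \<Longrightarrow> eval p \<Gamma> (EVar i) (\<Gamma> ! i) 1"
| Int: "eval p \<Gamma> (EInt k) (IntV k) 1"
| Nil: "eval p \<Gamma> ENil (ListV []) 1"
| Cons: "eval p \<Gamma> e1 v t1 \<Longrightarrow> eval p \<Gamma> e2 (ListV vs) t2 \<Longrightarrow>
    eval p \<Gamma> (ECons e1 e2) (ListV (v # vs)) (t1 + t2 + 1)"
| Arith: "eval p \<Gamma> e1 (IntV a) t1 \<Longrightarrow> eval p \<Gamma> e2 (IntV b) t2 \<Longrightarrow>
    eval p \<Gamma> (EArith f e1 e2) (IntV (arith_op f a b)) (t1 + t2 + 1)"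
| IfTrue: "eval p \<Gamma> e1 (IntV a) t1 \<Longrightarrow> eval p \<Gamma> e2 (IntV b) t2 \<Longrightarrow>
    compare_op c a b \<Longrightarrow> eval p \<Gamma> e3 v t3 \<Longrightarrow>
    eval p \<Gamma> (EIf c e1 e2 e3 e4) v (t1 + t2 + t3 + 1)"
| IfFalse: "eval p \<Gamma> e1 (IntV a) t1 \<Longrightarrow> eval p \<Gamma> e2 (IntV b) t2 \<Longrightarrow>
    \<not> compare_op c a b \<Longrightarrow> eval p \<Gamma> e4 v t4 \<Longrightarrow>
    eval p \<Gamma> (EIf c e1 e2 e3 e4) v (t1 + t2 + t4 + 1)"
| CaseNil: "eval p \<Gamma> e (ListV []) t1 \<Longrightarrow> eval p \<Gamma> e1 v t2 \<Longrightarrow>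
    eval p \<Gamma> (ECase e e1 e2) v (t1 + t2 + 1)"
| CaseCons: "eval p \<Gamma> e (ListV (w # ws)) t1 \<Longrightarrow> eval p (w # ListV ws # \<Gamma>) e2 v t2 \<Longrightarrow>
    eval p \<Gamma> (ECase e e1 e2) v (t1 + t2 + 1)"
| Let: "eval p \<Gamma> e1 w t1 \<Longrightarrow> eval p (w # \<Gamma>) e2 v t2 \<Longrightarrow>
    eval p \<Gamma> (ELet e1 e2) v (t1 + t2 + 1)"
| Call: "evals p \<Gamma> es vs t1 \<Longrightarrow> f < length p \<Longrightarrow> eval p vs (p ! f) v t2 \<Longrightarrow>
    eval p \<Gamma> (ECall f es) v (t1 + t2 + 1)"
| ArgsNil: "evals p \<Gamma> [] [] 0"
| ArgsCons: "eval p \<Gamma> e v t1 \<Longrightarrow> evals p \<Gamma> es vs t2 \<Longrightarrow>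
    evals p \<Gamma> (e # es) (v # vs) (t1 + t2)"

definition computes_in :: "program \<Rightarrow> val \<Rightarrow> val \<Rightarrow> nat \<Rightarrow> bool" where
  "computes_in p x y t \<longleftrightarrow> p \<noteq> [] \<and> eval p [x] (p ! 0) y t"

inductive_cases eval_elims:
  "eval p \<Gamma> (EVar i) v t"
  "eval p \<Gamma> (EInt k) v t"
  "eval p \<Gamma> ENil v t"
  "eval p \<Gamma> (ECons e1 e2) v t"
  "eval p \<Gamma> (EArith f e1 e2) v t"
  "eval p \<Gamma> (EIf c e1 e2 e3 e4) v t"
  "eval p \<Gamma> (ECase e e1 e2) v t"
  "eval p \<Gamma> (ELet e1 e2) v t"
  "eval p \<Gamma> (ECall f es) v t"
  "evals p \<Gamma> [] vs t"
  "evals p \<Gamma> (e # es) vs t"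

lemma eval_deterministic:
  "eval p \<Gamma> e v t \<Longrightarrow> eval p \<Gamma> e v' t' \<Longrightarrow> v' = v \<and> t' = t"
  "evals p \<Gamma> es vs t \<Longrightarrow> evals p \<Gamma> es vs' t' \<Longrightarrow> vs' = vs \<and> t' = t"
proof (induction arbitrary: v' t' and vs' t' rule: eval_evals.inducts)
  case Var from Var.prems show ?case by (rule eval_elims) simp
next
  case Int from Int.prems show ?case by (rule eval_elims) simp
next
  case Nil from Nil.prems show ?case by (rule eval_elims) simp
next
  case Cons from Cons.prems show ?case
    by (elim eval_elims) (auto dest!: Cons.IH(2) Cons.IH(4))
next
  case Arith from Arith.prems show ?case
    by (elim eval_elims) (auto dest!: Arith.IH(2) Arith.IH(4))
next
  case IfTrue from IfTrue.prems IfTrue.hyps show ?case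
    by (elim eval_elims) (auto dest!: IfTrue.IH(2) IfTrue.IH(4) IfTrue.IH(6))
next
  case IfFalse from IfFalse.prems IfFalse.hyps show ?case
    by (elim eval_elims) (auto dest!: IfFalse.IH(2) IfFalse.IH(4) IfFalse.IH(6))
next
  case CaseNil from CaseNil.prems show ?case
    by (elim eval_elims) (auto dest!: CaseNil.IH(2) CaseNil.IH(4))
next
  case CaseCons from CaseCons.prems show ?case
    by (elim eval_elims) (auto dest!: CaseCons.IH(2) CaseCons.IH(4))
next
  case Let from Let.prems show ?case
    by (elim eval_elims) (auto dest!: Let.IH(2) Let.IH(4))
next
  case Call from Call.prems show ?case
    by (elim eval_elims) (auto dest!: Call.IH(2) Call.IH(5))
next
  case ArgsNil from ArgsNil.prems show ?case by (rule eval_elims) simp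
next
  case ArgsCons from ArgsCons.prems show ?case
    by (elim eval_elims) (auto dest!: ArgsCons.IH(2) ArgsCons.IH(4))
qed

lemma computes_in_deterministic:
  "computes_in p x y t \<Longrightarrow> computes_in p x y' t' \<Longrightarrow> y' = y \<and> t' = t"
  unfolding computes_in_def using eval_deterministic(1) by blast

definition nat_val :: "nat \<Rightarrow> val" where
  "nat_val k = IntV (int k)"

definition nat_lists_val :: "nat list list \<Rightarrow> val" where
  "nat_lists_val xss = ListV (map (\<lambda>xs. ListV (map nat_val xs)) xss)"

end

theory Submission
  imports Defs
begin

text \<open>
  Every schedule can be split at the state in which all processes are at a global minimum, and
  the second half is a first half of the reversed processes; so it suffices to bring all processes
  down to a minimum. Cut the way of each process to its minimum into blocks that end at a new
  record minimum, and let the height of a block be its peak relative to its start. A block is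
  extended as long as it has not fallen to its start level or the next block is not higher, so
  that heights increase strictly within a process. Executing all blocks in the order
  of their heights is then optimal. A single right-to-left pass with amortised linear cost
  computes the blocks, and balanced merging sorts them in time \<open>O(n log N)\<close>, since
  the \<open>N\<close> block lists are already sorted.
\<close>

section \<open>Blocks of a process\<close>

text \<open>A schedule need not visit a state in which all processes are at a minimum, so the lower
  bound does not cut it. The whole schedule is compared with each of the two peaks, once forwards
  and once backwards in time, and its space is at least their maximum; the constructed schedule does
  pass through the common minimum and attains this value. The comparison uses only that no process
  skips a position and that every process gets to its end, so simultaneous moves are covered and
  moving one process at a time loses nothing.

  Extending blocks serves two purposes. Sorting all blocks by height then respects the order inside
  each process. Moreover, a block reaches its peak before its process falls below the start value of
  the block, because an absorbed part that raises the peak begins at or above that value. Hence a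
  process on the way to its next peak never makes room for the others.\<close>

text \<open>A block \<open>(h, d, i, c)\<close> consists of \<open>c\<close> steps of process \<open>i\<close>, rises at most \<open>h\<close> above its start
  value and changes the value by \<open>d\<close> in total. With \<open>e = 1\<close> the blocks lead to the last global
  minimum, with \<open>e = 0\<close> to the first one; using \<open>e = 0\<close> on the reversed process makes the two
  phases meet.\<close>

type_synonym block = "int \<times> int \<times> nat \<times> nat"

text \<open>The arguments \<open>h d i c\<close> are the block under construction, to be placed in
  front of finished blocks. If it has consumed everything and still has not fallen, it is dropped:
  its start is then the minimum sought. The peak of an absorbed block counts from level
  \<open>d\<close>, whence \<open>max h (d + h')\<close>.\<close>

fun absorb :: "int \<Rightarrow> nat \<Rightarrow> int \<Rightarrow> int \<Rightarrow> nat \<Rightarrow> block list \<Rightarrow> block list" where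
  "absorb e i h d c [] = (if d < e then [(h, d, i, c)] else [])"
| "absorb e i h d c ((h', d', i', c') # bs) =
    (if d < e \<and> h < h' then (h, d, i, c) # (h', d', i', c') # bs
     else absorb e i (max h (d + h')) (d + d') (c + c') bs)"

fun blocks :: "int \<Rightarrow> nat \<Rightarrow> int list \<Rightarrow> block list" where
  "blocks e i [] = []"
| "blocks e i [p] = []"
| "blocks e i (p # q # ps) = absorb e i (max 0 (q - p)) (q - p) 1 (blocks e i (q # ps))"

text \<open>The condition with \<open>1 - e\<close> makes the end of a block a record minimum, and
  the base case makes the last end a minimum of what follows. Over the integers, adding 1 expresses
  strictness, so \<open>e\<close> decides on which side of the cut ties are allowed. The position
  \<open>q\<close> records that the peak comes before any fall below the start; the lower bound
  rests on it.\<close>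

fun valid_blocks :: "int \<Rightarrow> int list \<Rightarrow> nat \<Rightarrow> block list \<Rightarrow> bool" where
  "valid_blocks e Q a [] \<longleftrightarrow> a < length Q \<and> (\<forall>u. a < u \<and> u < length Q \<longrightarrow> Q ! a + e \<le> Q ! u)"
| "valid_blocks e Q a ((h, d, i, c) # bs) \<longleftrightarrow>
     a + c < length Q \<and> Q ! (a + c) = Q ! a + d \<and>
     (\<forall>u. a \<le> u \<and> u \<le> a + c \<longrightarrow> Q ! u \<le> Q ! a + h) \<and>
     (\<forall>u. a \<le> u \<and> u < a + c \<longrightarrow> Q ! (a + c) + (1 - e) \<le> Q ! u) \<and>
     (\<exists>q. a \<le> q \<and> q \<le> a + c \<and> Q ! q = Q ! a + h \<and> (\<forall>u. a \<le> u \<and> u \<le> q \<longrightarrow> Q ! a \<le> Q ! u)) \<and>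
     valid_blocks e Q (a + c) bs"

abbreviation block_index :: "block \<Rightarrow> nat" where
  "block_index b \<equiv> fst (snd (snd b))"

abbreviation block_length :: "block \<Rightarrow> nat" where
  "block_length b \<equiv> snd (snd (snd b))"

text \<open>A block under construction may end above its start, so the assumption on record minima
  leaves out the position \<open>a\<close> itself; it is supplied by \<open>d < e\<close> once the
  block is closed.\<close>

lemma valid_blocks_absorb:
  assumes "valid_blocks e Q (a + c) bs" "0 \<le> e" "e \<le> 1" "0 < c"
    and "Q ! (a + c) = Q ! a + d"
    and "\<And>u. a \<le> u \<Longrightarrow> u \<le> a + c \<Longrightarrow> Q ! u \<le> Q ! a + h"
    and "\<And>u. a < u \<Longrightarrow> u < a + c \<Longrightarrow> Q ! (a + c) + (1 - e) \<le> Q ! u"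
    and "\<exists>q. a \<le> q \<and> q \<le> a + c \<and> Q ! q = Q ! a + h \<and> (\<forall>u. a \<le> u \<and> u \<le> q \<longrightarrow> Q ! a \<le> Q ! u)"
  shows "valid_blocks e Q a (absorb e i h d c bs)"
  using assms
proof (induction e i h d c bs rule: absorb.induct)
  case (1 e i h d c)
  show ?case
  proof (cases "d < e")
    case True
    have "Q ! (a + c) + (1 - e) \<le> Q ! u" if "a \<le> u" "u < a + c" for u
      using 1(7)[of u] 1(5) True that by (cases "u = a") auto
    with 1 True show ?thesis by simp
  next
    case False
    have "Q ! a + e \<le> Q ! u" if "a < u" "u < length Q" for u
    proof (cases u "a + c" rule: linorder_cases)
      case less
      with 1(7)[of u] that 1(5) False 1(3) show ?thesis by simp
    next
      case equal
      with 1(5) False show ?thesis by simp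
    next
      case greater
      with 1(1) that have "Q ! (a + c) + e \<le> Q ! u" by simp
      with 1(5) False 1(2) show ?thesis by simp
    qed
    with 1 False show ?thesis by simp
  qed
next
  case (2 e i h d c h' d' i' c' bs)
  from "2.prems"(1) have v: "a + c + c' < length Q" "Q ! (a + c + c') = Q ! (a + c) + d'"
    "\<And>u. a + c \<le> u \<Longrightarrow> u \<le> a + c + c' \<Longrightarrow> Q ! u \<le> Q ! (a + c) + h'"
    "\<And>u. a + c \<le> u \<Longrightarrow> u < a + c + c' \<Longrightarrow> Q ! (a + c + c') + (1 - e) \<le> Q ! u"
    "valid_blocks e Q (a + c + c') bs"
    by auto
  from "2.prems"(1) obtain q' where q': "a + c \<le> q'" "q' \<le> a + c + c'" "Q ! q' = Q ! (a + c) + h'"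
    "\<And>u. a + c \<le> u \<Longrightarrow> u \<le> q' \<Longrightarrow> Q ! (a + c) \<le> Q ! u"
    by auto
  show ?case
  proof (cases "d < e \<and> h < h'")
    case True
    have "Q ! (a + c) + (1 - e) \<le> Q ! u" if "a \<le> u" "u < a + c" for u
      using "2.prems"(7)[of u] "2.prems"(5) True that by (cases "u = a") auto
    moreover have "a + c < length Q" using v(1) by simp
    ultimately show ?thesis
      unfolding absorb.simps if_P[OF True] valid_blocks.simps(2)[of e Q a h d i c]
      using "2.prems"(1,5,6,8) by blast
  next
    case False
    have le: "Q ! (a + c + c') \<le> Q ! (a + c)"
      using v(4)[of "a + c"] "2.prems"(3) by (cases "c' = 0") auto
    have "valid_blocks e Q a (absorb e i (max h (d + h')) (d + d') (c + c') bs)"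
    proof (rule "2.IH"[OF False])
      show "valid_blocks e Q (a + (c + c')) bs" using v(5) by (simp add: add.assoc)
      show "0 \<le> e" "e \<le> 1" "0 < c + c'" using "2.prems" by auto
      show "Q ! (a + (c + c')) = Q ! a + (d + d')"
        using v(2) "2.prems"(5) by (simp add: add.assoc)
      show "Q ! u \<le> Q ! a + max h (d + h')" if "a \<le> u" "u \<le> a + (c + c')" for u
        using "2.prems"(6)[of u] v(3)[of u] "2.prems"(5) that by (cases "u \<le> a + c") auto
      show "Q ! (a + (c + c')) + (1 - e) \<le> Q ! u" if "a < u" "u < a + (c + c')" for u
        using "2.prems"(7)[of u] v(4)[of u] le that by (cases "u < a + c") (auto simp: add.assoc)
      show "\<exists>q\<ge>a. q \<le> a + (c + c') \<and> Q ! q = Q ! a + max h (d + h') \<and>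
          (\<forall>u. a \<le> u \<and> u \<le> q \<longrightarrow> Q ! a \<le> Q ! u)"
      proof (cases "d + h' \<le> h")
        case True
        then show ?thesis using "2.prems"(8) by (auto simp: max_def intro: trans_le_add1)
      next
        case F: False
        \<comment> \<open>If \<open>d < e\<close> held, then \<open>d\<close> \<le> 0 and, as the
          block is absorbed, \<open>h'\<close> \<le> \<open>h\<close>, so the new peak would not
          exceed \<open>h\<close>. Therefore the first part ends at or above its start and stays
          there throughout.\<close>
        with False "2.prems"(3) have d: "d \<ge> e" by auto
        have "Q ! a \<le> Q ! u" if "a \<le> u" "u \<le> q'" for u
        proof (cases u "a + c" rule: linorder_cases)
          case less
          then show ?thesis
            using "2.prems"(2,3,5) "2.prems"(7)[of u] d that by (cases "u = a") auto
        next
          case equal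
          then show ?thesis using "2.prems"(2,5) d by simp
        next
          case greater
          then show ?thesis using q'(4)[of u] "2.prems"(2,5) d that by simp
        qed
        then show ?thesis
          using q'(1-3) F "2.prems"(5) by (intro exI[of _ q']) auto
      qed
    qed
    then show ?thesis unfolding absorb.simps if_not_P[OF False] .
  qed
qed

lemma valid_blocks_ConsD:
  assumes "valid_blocks e Q a ((h, d, i, c) # bs)"
  shows "a + c < length Q" "Q ! (a + c) = Q ! a + d" "valid_blocks e Q (a + c) bs"
    and "\<And>u. a \<le> u \<Longrightarrow> u \<le> a + c \<Longrightarrow> Q ! u \<le> Q ! a + h"
    and "\<And>u. a \<le> u \<Longrightarrow> u < a + c \<Longrightarrow> Q ! (a + c) + (1 - e) \<le> Q ! u"
    and "\<exists>q. a \<le> q \<and> q \<le> a + c \<and> Q ! q = Q ! a + h \<and> (\<forall>u. a \<le> u \<and> u \<le> q \<longrightarrow> Q ! a \<le> Q ! u)"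
  using assms unfolding valid_blocks.simps by blast+

lemma valid_blocks_Cons: "valid_blocks e Q a bs \<Longrightarrow> valid_blocks e (p # Q) (Suc a) bs"
proof (induction e Q a bs rule: valid_blocks.induct)
  case (1 e Q a)
  then show ?case by (auto simp: nth_Cons split: nat.splits)
next
  case (2 e Q a h d i c bs)
  then obtain q where q: "a \<le> q" "q \<le> a + c" "Q ! q = Q ! a + h"
    "\<forall>u. a \<le> u \<and> u \<le> q \<longrightarrow> Q ! a \<le> Q ! u"
    by auto
  then have "\<exists>q\<ge>Suc a. q \<le> Suc (a + c) \<and> (p # Q) ! q = Q ! a + h \<and>
      (\<forall>u. Suc a \<le> u \<and> u \<le> q \<longrightarrow> Q ! a \<le> (p # Q) ! u)"
    by (intro exI[of _ "Suc q"]) (auto simp: nth_Cons split: nat.splits)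
  with 2 show ?case by (auto simp: nth_Cons split: nat.splits)
qed

lemma valid_blocks_blocks:
  "Q \<noteq> [] \<Longrightarrow> 0 \<le> e \<Longrightarrow> e \<le> 1 \<Longrightarrow> valid_blocks e Q 0 (blocks e i Q)"
proof (induction e i Q rule: blocks.induct)
  case (3 e i p q ps)
  have "valid_blocks e (p # q # ps) (0 + 1) (blocks e i (q # ps))"
    using 3 valid_blocks_Cons by simp
  moreover have "\<exists>r. 0 \<le> r \<and> r \<le> 0 + 1 \<and> (p # q # ps) ! r = (p # q # ps) ! 0 + max 0 (q - p) \<and>
      (\<forall>u. 0 \<le> u \<and> u \<le> r \<longrightarrow> (p # q # ps) ! 0 \<le> (p # q # ps) ! u)"
    by (cases "p \<le> q") (auto intro!: exI[of _ "if p \<le> q then 1 else 0"] simp: le_Suc_eq)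
  moreover have "(p # q # ps) ! u \<le> (p # q # ps) ! 0 + max 0 (q - p)" if "u \<le> 0 + 1" for u
    using that by (cases u) auto
  ultimately show ?case
    unfolding blocks.simps using 3(3,4) by (intro valid_blocks_absorb) auto
qed auto

lemma sorted_absorb:
  "sorted (map fst bs) \<Longrightarrow> sorted (map fst (absorb e i h d c bs))"
  by (induction e i h d c bs rule: absorb.induct) auto

lemma sorted_blocks: "sorted (map fst (blocks e i Q))"
  by (induction e i Q rule: blocks.induct) (auto intro: sorted_absorb)

lemma block_index_absorb:
  "\<forall>b\<in>set bs. block_index b = i \<Longrightarrow> b \<in> set (absorb e i h d c bs) \<Longrightarrow> block_index b = i"
  by (induction e i h d c bs rule: absorb.induct) (auto split: if_splits)

lemma block_index_blocks: "b \<in> set (blocks e i Q) \<Longrightarrow> block_index b = i"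
  by (induction e i Q arbitrary: b rule: blocks.induct) (auto dest: block_index_absorb[rotated])

section \<open>Lengths of block sequences and the global minimum\<close>

definition extent :: "block list \<Rightarrow> nat" where
  "extent bs = sum_list (map block_length bs)"

lemma extent_simps [simp]: "extent [] = 0" "extent (b # bs) = block_length b + extent bs"
  "extent (bs @ bs') = extent bs + extent bs'"
  by (simp_all add: extent_def)

text \<open>Block ends never rise, so the record minima chain: a cut between two blocks is a minimum
  of everything passed since \<open>a\<close>.\<close>

lemma valid_blocks_append:
  assumes "valid_blocks e Q a (bs @ bs')" "e \<le> 1"
  shows "valid_blocks e Q (a + extent bs) bs'"
    and "\<And>u. a \<le> u \<Longrightarrow> u < a + extent bs \<Longrightarrow> Q ! (a + extent bs) + (1 - e) \<le> Q ! u"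
  using assms
proof (induction bs arbitrary: a)
  case (Cons b bs)
  obtain h d i c where b: "b = (h, d, i, c)" by (cases b)
  {
    case 1
    with Cons.IH(1)[of "a + c"] show ?case by (simp add: b add.assoc)
  next
    case (2 u)
    then have v: "valid_blocks e Q (a + c) (bs @ bs')" by (simp add: b)
    note IH = Cons.IH(2)[OF _ _ v \<open>e \<le> 1\<close>]
    show ?case
    proof (cases "a + c \<le> u")
      case True
      then show ?thesis using IH[of u] 2 by (simp add: b add.assoc)
    next
      case False
      with 2 valid_blocks_ConsD(5) have "Q ! (a + c) + (1 - e) \<le> Q ! u"
        unfolding b append_Cons by simp
      moreover have "Q ! (a + c + extent bs) \<le> Q ! (a + c)"
        using IH[of "a + c"] \<open>e \<le> 1\<close> by (cases "extent bs = 0") auto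
      ultimately show ?thesis by (simp add: b add.assoc)
    qed
  }
qed auto

lemma valid_blocks_min:
  assumes "valid_blocks e Q 0 bs" "0 \<le> e" "e \<le> 1"
  shows "extent bs < length Q"
    and "\<And>u. u < extent bs \<Longrightarrow> Q ! extent bs + (1 - e) \<le> Q ! u"
    and "\<And>u. extent bs < u \<Longrightarrow> u < length Q \<Longrightarrow> Q ! extent bs + e \<le> Q ! u"
  using valid_blocks_append[of e Q 0 bs "[]"] assms by auto

section \<open>Executing sorted blocks\<close>

fun peak :: "int \<Rightarrow> block list \<Rightarrow> int" where
  "peak T [] = T"
| "peak T ((h, d, i, c) # M) = max (T + h) (peak (T + d) M)"

definition level :: "int list list \<Rightarrow> (nat \<Rightarrow> nat) \<Rightarrow> int" where
  "level Qs x = (\<Sum>j<length Qs. Qs ! j ! x j)"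

definition expand :: "block list \<Rightarrow> nat list" where
  "expand M = concat (map (\<lambda>b. replicate (block_length b) (block_index b)) M)"

abbreviation of_index :: "nat \<Rightarrow> block list \<Rightarrow> block list" where
  "of_index j M \<equiv> filter (\<lambda>b. block_index b = j) M"

lemma count_list_replicate: "count_list (replicate n x) y = (if x = y then n else 0)"
  by (induction n) auto

lemma count_expand: "count_list (expand M) j = extent (of_index j M)"
  by (induction M) (auto simp: expand_def count_list_replicate)

declare valid_blocks.simps(2) [simp del]

lemma take_expand_Cons:
  "(\<exists>k\<le>c. take t (expand ((h, d, i, c) # M)) = replicate k i) \<or>
    (\<exists>t'. take t (expand ((h, d, i, c) # M)) = replicate c i @ take t' (expand M))"
  by (cases "t \<le> c") (auto simp: expand_def)

lemma level_add_one:
  assumes "i < length Qs"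
  shows "level Qs (\<lambda>j. x j + (if i = j then k else 0)) = level Qs x - Qs ! i ! x i + Qs ! i ! (x i + k)"
proof -
  let ?y = "\<lambda>j. x j + (if i = j then k else 0)"
  have "level Qs y = Qs ! i ! y i + (\<Sum>j\<in>{..<length Qs} - {i}. Qs ! j ! y j)" for y
    unfolding level_def using assms by (simp add: sum.remove)
  from this[of x] this[of ?y] show ?thesis by simp
qed

text \<open>Within a block only one process moves, so the total follows its value and stays within
  \<open>h\<close> of the total at the start of the block. The start \<open>x\<close> is general
  because the induction continues from the end of the first block.\<close>

lemma level_expand_le_peak:
  assumes "\<And>b. b \<in> set M \<Longrightarrow> block_index b < length Qs"
    and "\<And>j. j < length Qs \<Longrightarrow> valid_blocks e (Qs ! j) (x j) (of_index j M)"
  shows "level Qs (\<lambda>j. x j + count_list (take t (expand M)) j) \<le> peak (level Qs x) M"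
  using assms
proof (induction M arbitrary: x t)
  case Nil
  then show ?case by (simp add: expand_def)
next
  case (Cons b M)
  obtain h d i c where b: "b = (h, d, i, c)" by (cases b)
  have i: "i < length Qs" using Cons.prems(1)[of b] b by simp
  have v: "valid_blocks e (Qs ! i) (x i) ((h, d, i, c) # of_index i M)"
    using Cons.prems(2)[OF i] by (simp add: b)
  let ?x' = "\<lambda>j. x j + (if i = j then c else 0)"
  have level': "level Qs ?x' = level Qs x + d"
    using valid_blocks_ConsD(2)[OF v] i by (simp add: level_add_one)
  from take_expand_Cons[of c t h d i M] show ?case
  proof (elim disjE exE conjE)
    fix k assume k: "k \<le> c" "take t (expand ((h, d, i, c) # M)) = replicate k i"
    have "level Qs (\<lambda>j. x j + count_list (replicate k i) j) \<le> level Qs x + h"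
      using valid_blocks_ConsD(4)[OF v, of "x i + k"] k(1) i by (simp add: count_list_replicate level_add_one)
    then show ?thesis by (simp add: k b)
  next
    fix t' assume t': "take t (expand ((h, d, i, c) # M)) = replicate c i @ take t' (expand M)"
    have "level Qs (\<lambda>j. ?x' j + count_list (take t' (expand M)) j) \<le> peak (level Qs ?x') M"
    proof (rule Cons.IH)
      show "valid_blocks e (Qs ! j) (?x' j) (of_index j M)" if "j < length Qs" for j
        using Cons.prems(2)[OF that] by (auto simp: b dest: valid_blocks_ConsD(3))
    qed (use Cons.prems(1) in auto)
    then show ?thesis by (simp add: t' b level' count_list_replicate add.assoc)
  qed
qed

section \<open>Lower bound: every schedule reaches the peak of the sorted blocks\<close>

lemma le_peak_cases:
  assumes "K \<le> peak T M"
  shows "K \<le> T + sum_list (map (\<lambda>b. fst (snd b)) M) \<or>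
    (\<exists>M1 h d i c M2. M = M1 @ (h, d, i, c) # M2 \<and> K \<le> T + sum_list (map (\<lambda>b. fst (snd b)) M1) + h)"
  using assms
proof (induction T M rule: peak.induct)
  case (2 T h d i c M)
  show ?case
  proof (cases "K \<le> T + h")
    case True
    then have "(h, d, i, c) # M = [] @ (h, d, i, c) # M \<and>
        K \<le> T + sum_list (map (\<lambda>b. fst (snd b)) []) + h" by simp
    then show ?thesis by blast
  next
    case False
    with 2 have "K \<le> T + d + sum_list (map (\<lambda>b. fst (snd b)) M) \<or>
      (\<exists>M1 h d' i c M2. M = M1 @ (h, d', i, c) # M2 \<and>
        K \<le> T + d + sum_list (map (\<lambda>b. fst (snd b)) M1) + h)" by simp
    then show ?thesis
    proof (elim disjE exE conjE)
      fix M1 h' d' i' c' M2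
      assume M: "M = M1 @ (h', d', i', c') # M2"
        and K: "K \<le> T + d + sum_list (map (\<lambda>b. fst (snd b)) M1) + h'"
      have "(h, d, i, c) # M = ((h, d, i, c) # M1) @ (h', d', i', c') # M2 \<and>
        K \<le> T + sum_list (map (\<lambda>b. fst (snd b)) ((h, d, i, c) # M1)) + h'"
        using M K by simp
      then show ?thesis by blast
    qed simp
  qed
qed simp

text \<open>Validity is only available for complete block sequences, whereas the level is wanted
  after a prefix; \<open>M'\<close> stands for the blocks still to come.\<close>

lemma level_extent:
  assumes "\<And>b. b \<in> set M \<Longrightarrow> block_index b < length Qs"
    and "\<And>j. j < length Qs \<Longrightarrow> valid_blocks e (Qs ! j) (x j) (of_index j (M @ M'))"
  shows "level Qs (\<lambda>j. x j + extent (of_index j M)) = level Qs x + sum_list (map (\<lambda>b. fst (snd b)) M)"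
  using assms
proof (induction M arbitrary: x)
  case (Cons b M)
  obtain h d i c where b: "b = (h, d, i, c)" by (cases b)
  have i: "i < length Qs" using Cons.prems(1)[of b] b by simp
  let ?x' = "\<lambda>j. x j + (if i = j then c else 0)"
  have v: "valid_blocks e (Qs ! i) (x i) ((h, d, i, c) # of_index i (M @ M'))"
    using Cons.prems(2)[OF i] by (simp add: b)
  have level': "level Qs ?x' = level Qs x + d"
    using valid_blocks_ConsD(2)[OF v] i by (simp add: level_add_one)
  have "level Qs (\<lambda>j. ?x' j + extent (of_index j M)) = level Qs ?x' + sum_list (map (\<lambda>b. fst (snd b)) M)"
  proof (rule Cons.IH)
    show "valid_blocks e (Qs ! j) (?x' j) (of_index j (M @ M'))" if "j < length Qs" for j
      using Cons.prems(2)[OF that] by (auto simp: b dest: valid_blocks_ConsD(3))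
  qed (use Cons.prems(1) in auto)
  moreover have "?x' j + extent (of_index j M) = x j + extent (of_index j (b # M))" for j
    by (simp add: b)
  ultimately show ?case by (simp add: level' b)
qed simp

text \<open>Consider the first time at which some process \<open>j\<close> with remaining blocks reaches the peak
  of its next block. No other process has gone below its current level by then, and by the order
  of the blocks this peak is at least as high as that of the next block in \<open>M\<close>.\<close>

lemma ex_level_ge_peak:
  fixes f :: "nat \<Rightarrow> nat \<Rightarrow> nat"
  assumes idx: "\<And>b. b \<in> set M \<Longrightarrow> block_index b < length Qs"
    and valid: "\<And>j. j < length Qs \<Longrightarrow> valid_blocks e (Qs ! j) 0 (of_index j M)"
    and e: "0 \<le> e" "e \<le> 1"
    and sorted: "sorted (map fst M)"
    and start: "\<And>j. j < length Qs \<Longrightarrow> f 0 j = 0"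
    and step: "\<And>t j. t < L \<Longrightarrow> j < length Qs \<Longrightarrow> f (Suc t) j \<le> Suc (f t j)"
    and range: "\<And>t j. t \<le> L \<Longrightarrow> j < length Qs \<Longrightarrow> f t j < length (Qs ! j)"
    and end_: "\<And>j. j < length Qs \<Longrightarrow> f L j = length (Qs ! j) - 1"
  shows "\<exists>t\<le>L. peak (level Qs (\<lambda>j. 0)) M \<le> level Qs (f t)"
proof -
  let ?D = "\<lambda>M. sum_list (map (\<lambda>b. fst (snd b)) M)"
  from le_peak_cases[OF order_refl, of "level Qs (\<lambda>j. 0)" M] show ?thesis
  proof (elim disjE exE conjE)
    assume le: "peak (level Qs (\<lambda>j. 0)) M \<le> level Qs (\<lambda>j. 0) + ?D M"
    have "level Qs (\<lambda>j. 0 + extent (of_index j M)) = level Qs (\<lambda>j. 0) + ?D M"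
      using idx valid by (intro level_extent[where M' = "[]"]) auto
    \<comment> \<open>After all of \<open>M\<close> each process is at its global minimum, so no
      state of the schedule has a smaller total; the final state is as good as any.\<close>
    moreover have "level Qs (\<lambda>j. extent (of_index j M)) \<le> level Qs (f L)"
      unfolding level_def
    proof (intro sum_mono)
      fix j assume "j \<in> {..<length Qs}"
      then have j: "j < length Qs" by simp
      note m = valid_blocks_min[OF valid[OF j] e]
      have "f L j < length (Qs ! j)" using m(1) end_[OF j] by simp
      then show "Qs ! j ! extent (of_index j M) \<le> Qs ! j ! f L j"
        using m(2)[of "f L j"] m(3)[of "f L j"] e
        by (cases "f L j" "extent (of_index j M)" rule: linorder_cases) auto
    qed
    ultimately show ?thesis using le by (intro exI[of _ L]) simp
  next
    fix M1 h d i c M2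
    assume M: "M = M1 @ (h, d, i, c) # M2"
      and le: "peak (level Qs (\<lambda>j. 0)) M \<le> level Qs (\<lambda>j. 0) + ?D M1 + h"
    define x where "x j = extent (of_index j M1)" for j
    let ?R = "\<lambda>j. of_index j ((h, d, i, c) # M2)"
    have i: "i < length Qs" using idx[of "(h, d, i, c)"] M by simp
    have lev: "level Qs x = level Qs (\<lambda>j. 0) + ?D M1"
      using level_extent[of M1 Qs e "\<lambda>j. 0" "(h, d, i, c) # M2"] idx valid M
      unfolding x_def by auto
    have vx: "valid_blocks e (Qs ! j) (x j) (?R j)"
      and xmin: "u < x j \<Longrightarrow> Qs ! j ! x j \<le> Qs ! j ! u" if "j < length Qs" for j u
    proof -
      have "valid_blocks e (Qs ! j) 0 (of_index j M1 @ ?R j)"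
        using valid[OF that] by (simp add: M)
      note app = valid_blocks_append[OF this e(2)]
      from app(1) show "valid_blocks e (Qs ! j) (x j) (?R j)" by (simp add: x_def)
      from app(2)[of u] e(2) show "Qs ! j ! x j \<le> Qs ! j ! u" if "u < x j"
        using that by (simp add: x_def)
    qed
    have "\<exists>q. x j \<le> q \<and> q < length (Qs ! j) \<and> Qs ! j ! x j + h \<le> Qs ! j ! q \<and>
        (\<forall>u. u \<le> q \<longrightarrow> Qs ! j ! x j \<le> Qs ! j ! u)" if j: "j < length Qs" and R: "?R j \<noteq> []" for j
    proof -
      obtain h' d' i' c' bs where R': "?R j = (h', d', i', c') # bs"
        using R by (cases "?R j") auto
      then have "(h', d', i', c') \<in> set ((h, d, i, c) # M2)"
        by (metis filter_is_subset list.set_intros(1) subsetD)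
      then have "h \<le> h'" using sorted by (auto simp: M sorted_append)
      moreover obtain q where "x j \<le> q" "q \<le> x j + c'" "Qs ! j ! q = Qs ! j ! x j + h'"
        "\<forall>u. x j \<le> u \<and> u \<le> q \<longrightarrow> Qs ! j ! x j \<le> Qs ! j ! u"
        and "x j + c' < length (Qs ! j)"
        using valid_blocks_ConsD(1,6)[OF vx[OF j, unfolded R']] by blast
      \<comment> \<open>The block only controls positions from \<open>x j\<close> on; those before
        it are covered because \<open>x j\<close> is a record minimum.\<close>
      moreover have "Qs ! j ! x j \<le> Qs ! j ! u" if "u \<le> q" for u
        using calculation(5) xmin[OF j, of u] that by (cases "u < x j") auto
      ultimately show ?thesis by (intro exI[of _ q]) auto
    qed
    then have "\<forall>j. \<exists>q. j < length Qs \<and> ?R j \<noteq> [] \<longrightarrow> q < length (Qs ! j) \<and>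
        Qs ! j ! x j + h \<le> Qs ! j ! q \<and> (\<forall>u. u \<le> q \<longrightarrow> Qs ! j ! x j \<le> Qs ! j ! u)"
      by blast
    from choice[OF this] obtain q where
      "\<forall>j. j < length Qs \<and> ?R j \<noteq> [] \<longrightarrow> q j < length (Qs ! j) \<and>
        Qs ! j ! x j + h \<le> Qs ! j ! q j \<and> (\<forall>u. u \<le> q j \<longrightarrow> Qs ! j ! x j \<le> Qs ! j ! u)" ..
    then have q: "q j < length (Qs ! j)" "Qs ! j ! x j + h \<le> Qs ! j ! q j"
      "u \<le> q j \<Longrightarrow> Qs ! j ! x j \<le> Qs ! j ! u" if "j < length Qs" "?R j \<noteq> []" for j u
      using that by blast+
    define hit where "hit t \<longleftrightarrow> (\<exists>j<length Qs. ?R j \<noteq> [] \<and> q j \<le> f t j)" for t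
    \<comment> \<open>Process \<open>i\<close> still owns the block that attains the peak, and at
      time \<open>L\<close> it is at its last position, hence not before \<open>q i\<close>. So a
      first hit exists.\<close>
    have "hit L"
      unfolding hit_def using i q(1)[of i] end_[OF i] by (intro exI[of _ i]) auto
    define t where "t = (LEAST t. hit t)"
    have t: "hit t" "t \<le> L" "\<And>t'. t' < t \<Longrightarrow> \<not> hit t'"
      unfolding t_def using \<open>hit L\<close> by (auto intro: LeastI Least_le dest: not_less_Least)
    \<comment> \<open>Positions advance by at most one, so at the first hit nobody has jumped past
      its own \<open>q j\<close>, and the process that hits stands exactly on it.\<close>
    have below: "f t j \<le> q j" if "j < length Qs" "?R j \<noteq> []" for j
    proof (cases t)
      case 0
      then show ?thesis using start that by simp
    next
      case (Suc t')
      then have "f t' j < q j" using t(3)[of t'] that by (auto simp: hit_def not_le)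
      moreover have "f t j \<le> Suc (f t' j)" using step[of t' j] Suc t(2) that by simp
      ultimately show ?thesis by simp
    qed
    from t(1) obtain k where k: "k < length Qs" "?R k \<noteq> []" "f t k = q k"
      unfolding hit_def using below le_antisym by blast
    have "Qs ! j ! x j \<le> Qs ! j ! f t j" if j: "j < length Qs" for j
    proof (cases "?R j = []")
      case True
      \<comment> \<open>A process without remaining blocks has \<open>x j\<close> at its global
        minimum, so its current value cannot be smaller.\<close>
      then have "x j = extent (of_index j M)" by (simp add: x_def M del: filter.simps)
      then show ?thesis
        using valid_blocks_min(2,3)[OF valid[OF j] e, of "f t j"] range[OF t(2) j] e
        by (cases "f t j" "x j" rule: linorder_cases) auto
    next
      case False
      then show ?thesis using q(3) below j by blast
    qed
    then have "(\<Sum>j\<in>{..<length Qs} - {k}. Qs ! j ! x j) \<le> (\<Sum>j\<in>{..<length Qs} - {k}. Qs ! j ! f t j)"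
      by (intro sum_mono) auto
    then have "level Qs x + h \<le> level Qs (f t)"
      using q(2)[OF k(1,2)] k unfolding level_def by (simp add: sum.remove[of _ k])
    then show ?thesis using le lev t(2) by (intro exI[of _ t]) simp
  qed
qed

section \<open>An optimal interleaving\<close>

fun block_lists :: "int \<Rightarrow> nat \<Rightarrow> int list list \<Rightarrow> block list list" where
  "block_lists e k [] = []"
| "block_lists e k (Q # Qs) = blocks e k Q # block_lists e (Suc k) Qs"

definition merged :: "int \<Rightarrow> int list list \<Rightarrow> block list" where
  "merged e Qs = sort_key fst (concat (block_lists e 0 Qs))"

lemma block_index_block_lists:
  "b \<in> set (concat (block_lists e k Qs)) \<Longrightarrow> k \<le> block_index b \<and> block_index b < k + length Qs"
proof (induction e k Qs rule: block_lists.induct)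
  case (2 e k Q Qs)
  show ?case
  proof (cases "b \<in> set (blocks e k Q)")
    case True
    then show ?thesis using block_index_blocks by simp
  next
    case False
    then show ?thesis using 2 by simp
  qed
qed simp

lemma of_index_block_lists:
  "of_index j (concat (block_lists e k Qs)) =
    (if k \<le> j \<and> j < k + length Qs then blocks e j (Qs ! (j - k)) else [])"
proof (induction e k Qs rule: block_lists.induct)
  case (2 e k Q Qs)
  have "of_index j (blocks e k Q) = (if j = k then blocks e k Q else [])"
    using block_index_blocks[of _ e k Q] by (auto simp: filter_empty_conv filter_id_conv)
  then show ?case using 2 by (auto simp: nth_Cons' Suc_diff_le)
qed auto

text \<open>Filtering commutes with the stable \<open>sort_key\<close>, and the blocks of a single
  process are sorted already, so restricting to one process gives back its own block list.\<close>

lemma merged: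
  shows "b \<in> set (merged e Qs) \<Longrightarrow> block_index b < length Qs"
    and "j < length Qs \<Longrightarrow> of_index j (merged e Qs) = blocks e j (Qs ! j)"
    and "sorted (map fst (merged e Qs))"
  using block_index_block_lists[of b e 0 Qs] of_index_block_lists[of j e 0 Qs]
  by (auto simp: merged_def filter_sort sort_key_id_if_sorted sorted_blocks simp del: filter_concat)

text \<open>The first global minimum of \<open>rev Q\<close> is the last one of \<open>Q\<close>,
  which is where \<open>e = 1\<close> leads. With the same tie rule on both sides the two phases
  would overlap or leave a gap between repeated minima.\<close>

lemma extent_blocks_rev:
  assumes "Q \<noteq> []"
  shows "extent (blocks 1 i Q) + extent (blocks 0 j (rev Q)) = length Q - 1"
proof -
  define m p where "m = extent (blocks 1 i Q)" and "p = length Q - 1 - extent (blocks 0 j (rev Q))"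
  note A = valid_blocks_min[OF valid_blocks_blocks[of Q 1 i], folded m_def]
  note B = valid_blocks_min[OF valid_blocks_blocks[of "rev Q" 0 j]]
  have len: "m < length Q" "p < length Q" "extent (blocks 0 j (rev Q)) = length Q - 1 - p"
    using A(1) B(1) assms by (auto simp: p_def)
  have "Q ! p + 1 \<le> Q ! v" if "p < v" "v < length Q" for v
    using B(2)[of "length Q - 1 - v"] assms that len by (simp add: rev_nth)
  moreover have "Q ! p \<le> Q ! v" if "v < p" for v
    using B(3)[of "length Q - 1 - v"] assms that len by (simp add: rev_nth)
  ultimately have "p = m"
    using A(2)[of p] A(3)[of p] len assms by (cases p m rule: linorder_cases) force+
  then show ?thesis using len by (simp flip: m_def)
qed

lemma level_rev:
  assumes "\<And>j. j < length Qs \<Longrightarrow> y j < length (Qs ! j)"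
  shows "level (map rev Qs) (\<lambda>j. length (Qs ! j) - 1 - y j) = level Qs y"
  unfolding level_def using assms by (force intro!: sum.cong simp: rev_nth)

lemma level_cong: "(\<And>j. j < length Qs \<Longrightarrow> x j = y j) \<Longrightarrow> level Qs x = level Qs y"
  unfolding level_def by simp

definition int_paths :: "process list \<Rightarrow> int list list" where
  "int_paths Ps = map (map int) Ps"

lemma int_paths_nth [simp]: "length (int_paths Ps) = length Ps"
  "j < length Ps \<Longrightarrow> int_paths Ps ! j = map int (Ps ! j)"
  by (simp_all add: int_paths_def)

lemma sum_list_entries:
  assumes "\<And>j. j < length Ps \<Longrightarrow> s ! j < length (Ps ! j)"
  shows "int (sum_list (entries Ps s)) = level (int_paths Ps) (\<lambda>j. s ! j)"
  unfolding level_def entries_def using assms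
  by (simp add: interv_sum_list_conv_sum_set_nat atLeast0LessThan)

section \<open>The lower bound in both directions of time\<close>

definition peak_of :: "int \<Rightarrow> int list list \<Rightarrow> int" where
  "peak_of e Qs = peak (level Qs (\<lambda>j. 0)) (merged e Qs)"

text \<open>Indices never decrease and the last tuple is prescribed, so it bounds all earlier ones;
  the induction therefore runs backwards from the end.\<close>

lemma index_tuples_nth_le:
  assumes "index_tuples Ps ss" "t < length ss" "j < length Ps"
  shows "length (ss ! t) = length Ps" "ss ! t ! j \<le> length (Ps ! j) - 1"
proof -
  have idx: "index_step (ss ! t) (ss ! Suc t)" if "Suc t < length ss" for t
    using assms(1) that by (simp add: index_tuples_def)
  have last: "ss ! (length ss - 1) = map (\<lambda>P. length P - 1) Ps"
    using assms(1) last_conv_nth[of ss] by (auto simp: index_tuples_def)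
  have "t \<le> length ss - 1" using assms(2) by simp
  then have "length (ss ! t) = length Ps \<and> ss ! t ! j \<le> length (Ps ! j) - 1"
  proof (induction rule: inc_induct)
    case base
    then show ?case using last assms(3) by simp
  next
    case (step n)
    then have "index_step (ss ! n) (ss ! Suc n)" using idx by simp
    then have "length (ss ! Suc n) = length (ss ! n)"
      "j < length (ss ! n) \<Longrightarrow> ss ! n ! j \<le> ss ! Suc n ! j"
      by (auto simp: index_step_def)
    then show ?case using step.IH assms(3) by simp
  qed
  then show "length (ss ! t) = length Ps" "ss ! t ! j \<le> length (Ps ! j) - 1" by auto
qed

lemma ex_ge_peak_of:
  assumes "processes Ps" "index_tuples Ps ss"
  shows "\<exists>s\<in>set ss. peak_of 1 (int_paths Ps) \<le> int (sum_list (entries Ps s))"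
    and "\<exists>s\<in>set ss. peak_of 0 (map rev (int_paths Ps)) \<le> int (sum_list (entries Ps s))"
proof -
  let ?Qs = "int_paths Ps" and ?L = "length ss - 1"
  have ss: "ss \<noteq> []" "ss ! 0 = replicate (length Ps) 0" "ss ! ?L = map (\<lambda>P. length P - 1) Ps"
    using assms(2) last_conv_nth[of ss] hd_conv_nth[of ss] by (auto simp: index_tuples_def)
  have step: "index_step (ss ! t) (ss ! Suc t)" if "Suc t < length ss" for t
    using assms(2) that by (simp add: index_tuples_def)
  have Ps: "0 < length (Ps ! j)" "Ps ! j \<noteq> []" if "j < length Ps" for j
    using assms(1) that by (auto simp: processes_def)
  have range: "ss ! t ! j < length (Ps ! j)" if "t \<le> ?L" "j < length Ps" for t j
  proof -
    have "t < length ss" using that(1) ss(1) by (cases ss) auto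
    from index_tuples_nth_le(2)[OF assms(2) this that(2)] Ps(1)[OF that(2)] show ?thesis
      by linarith
  qed
  have len: "length (ss ! t) = length Ps" if "t \<le> ?L" for t
  proof -
    have "t < length ss" using that(1) ss(1) by (cases ss) auto
    moreover have "0 < length Ps" using assms(1) by (auto simp: processes_def)
    ultimately show ?thesis using index_tuples_nth_le(1)[OF assms(2)] by blast
  qed
  have cost: "int (sum_list (entries Ps (ss ! t))) = level ?Qs (\<lambda>j. ss ! t ! j)" if "t \<le> ?L" for t
    using range that by (intro sum_list_entries) auto
  have one: "ss ! t ! j \<le> ss ! Suc t ! j \<and> ss ! Suc t ! j \<le> Suc (ss ! t ! j)"
    if "t < ?L" "j < length Ps" for t j
  proof -
    have "Suc t < length ss" using that(1) by simp
    from step[OF this] show ?thesis using len[of t] that unfolding index_step_def by fastforce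
  qed
  have mem: "ss ! t \<in> set ss" if "t \<le> ?L" for t
    using that ss(1) by (intro nth_mem) (cases ss, auto)
  have "\<exists>t\<le>?L. peak_of 1 ?Qs \<le> level ?Qs (\<lambda>j. ss ! t ! j)"
    unfolding peak_of_def
  proof (rule ex_level_ge_peak[where e = 1])
    show "valid_blocks 1 (?Qs ! j) 0 (of_index j (merged 1 ?Qs))" if "j < length ?Qs" for j
      using that Ps by (simp add: merged valid_blocks_blocks)
    show "block_index b < length ?Qs" if "b \<in> set (merged 1 ?Qs)" for b
      using merged(1)[OF that] .
    show "ss ! Suc t ! j \<le> Suc (ss ! t ! j)" if "t < ?L" "j < length ?Qs" for t j
      using one that by simp
    show "ss ! t ! j < length (?Qs ! j)" if "t \<le> ?L" "j < length ?Qs" for t j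
      using range that by simp
    show "ss ! ?L ! j = length (?Qs ! j) - 1" if "j < length ?Qs" for j
      unfolding ss(3) using that by simp
  qed (simp_all add: ss(2) merged(3))
  then show "\<exists>s\<in>set ss. peak_of 1 (int_paths Ps) \<le> int (sum_list (entries Ps s))"
    using mem cost by metis
  \<comment> \<open>The schedule read backwards, with positions counted from the other end: again a
    walk from first to last positions that skips none, now on the reversed processes.\<close>
  let ?f = "\<lambda>t j. length (?Qs ! j) - 1 - ss ! (?L - t) ! j"
  have "\<exists>t\<le>?L. peak_of 0 (map rev ?Qs) \<le> level (map rev ?Qs) (?f t)"
    unfolding peak_of_def
  proof (rule ex_level_ge_peak[where e = 0])
    show "valid_blocks 0 (map rev ?Qs ! j) 0 (of_index j (merged 0 (map rev ?Qs)))"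
      if "j < length (map rev ?Qs)" for j
      using that Ps by (simp add: merged valid_blocks_blocks)
    show "?f (Suc t) j \<le> Suc (?f t j)" if "t < ?L" "j < length (map rev ?Qs)" for t j
    proof -
      have "Suc (?L - Suc t) = ?L - t" "?L - Suc t < ?L" using that(1) by auto
      then show ?thesis using one[of "?L - Suc t" j] that(2) by simp linarith
    qed
    show "?f t j < length (map rev ?Qs ! j)" if "j < length (map rev ?Qs)" for t j
      using Ps that by simp
    show "block_index b < length (map rev ?Qs)" if "b \<in> set (merged 0 (map rev ?Qs))" for b
      using merged(1)[OF that] .
    show "?f 0 j = 0" if "j < length (map rev ?Qs)" for j
      unfolding diff_zero ss(3) using that by simp
  qed (simp_all add: ss(2) merged(3))
  then obtain t where t: "t \<le> ?L" "peak_of 0 (map rev ?Qs) \<le> level (map rev ?Qs) (?f t)" by blast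
  moreover have "level (map rev ?Qs) (?f t) = level ?Qs (\<lambda>j. ss ! (?L - t) ! j)"
    using range by (intro level_rev) auto
  ultimately show "\<exists>s\<in>set ss. peak_of 0 (map rev (int_paths Ps)) \<le> int (sum_list (entries Ps s))"
    using cost[OF diff_le_self, of t]
    by (intro bexI[OF _ mem[OF diff_le_self, of t]]) linarith
qed

section \<open>The schedule made of both phases and its optimality\<close>

definition moves :: "process list \<Rightarrow> nat list" where
  "moves Ps = expand (merged 1 (int_paths Ps)) @ rev (expand (merged 0 (map rev (int_paths Ps))))"

definition tuples_of :: "nat \<Rightarrow> nat list \<Rightarrow> nat list list" where
  "tuples_of N ms = map (\<lambda>t. map (count_list (take t ms)) [0..<N]) [0..<Suc (length ms)]"

definition optimum :: "process list \<Rightarrow> int" where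
  "optimum Ps = max (peak_of 1 (int_paths Ps)) (peak_of 0 (map rev (int_paths Ps)))"

lemma set_expand: "set (expand M) \<subseteq> block_index ` set M"
  by (auto simp: expand_def intro: rev_image_eqI)

lemma moves_less: "i \<in> set (moves Ps) \<Longrightarrow> i < length Ps"
  using merged(1)[of _ 1 "int_paths Ps"] merged(1)[of _ 0 "map rev (int_paths Ps)"]
    set_expand[of "merged 1 (int_paths Ps)"] set_expand[of "merged 0 (map rev (int_paths Ps))"]
  by (auto simp: moves_def)

lemma count_moves:
  assumes "processes Ps" "j < length Ps"
  shows "count_list (moves Ps) j = length (Ps ! j) - 1"
  using assms extent_blocks_rev[of "map int (Ps ! j)" j j]
  by (auto simp: moves_def count_expand merged processes_def)

lemma index_tuples_tuples_of:
  assumes "\<And>i. i \<in> set ms \<Longrightarrow> i < length Ps"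
    and "\<And>j. j < length Ps \<Longrightarrow> count_list ms j = length (Ps ! j) - 1"
  shows "index_tuples Ps (tuples_of (length Ps) ms)"
    and "given_by_moves Ps (map (entries Ps) (tuples_of (length Ps) ms)) (map (\<lambda>i. [i]) ms)"
proof -
  let ?ss = "tuples_of (length Ps) ms"
  have nth: "?ss ! t = map (count_list (take t ms)) [0..<length Ps]" if "t \<le> length ms" for t
    using that unfolding tuples_of_def by (subst nth_map) (auto simp del: upt_Suc)
  have len: "length ?ss = length ms + 1" by (simp add: tuples_of_def)
  have Suc: "?ss ! (t + 1) ! i = ?ss ! t ! i + (if ms ! t = i then 1 else 0)"
    if "t < length ms" "i < length Ps" for t i
    using that by (simp add: nth take_Suc_conv_app_nth)
  have step: "index_step (?ss ! t) (?ss ! (t + 1))" if "t < length ms" for t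
  proof -
    have "ms ! t < length Ps" using assms(1) that by simp
    then have "?ss ! (t + 1) \<noteq> ?ss ! t" using Suc[OF that, of "ms ! t"] by auto
    moreover have "length (?ss ! t) = length Ps" "length (?ss ! (t + 1)) = length Ps"
      using that by (simp_all add: nth)
    ultimately show ?thesis using Suc[OF that] by (auto simp: index_step_def)
  qed
  have ne: "?ss \<noteq> []" using len by auto
  have "hd ?ss = replicate (length Ps) 0"
    unfolding hd_conv_nth[OF ne]
    unfolding nth[OF le0] by (auto intro: nth_equalityI)
  moreover have "last ?ss = map (\<lambda>P. length P - 1) Ps"
    unfolding last_conv_nth[OF ne] len
    using assms(2) by (auto simp: nth intro: nth_equalityI)
  ultimately show tup: "index_tuples Ps ?ss"
    unfolding index_tuples_def using step len ne by simp
  have move: "set [ms ! t] = {i. i < length Ps \<and> ?ss ! (t + 1) ! i = ?ss ! t ! i + 1}"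
    if "t < length ms" for t
  proof -
    have "ms ! t < length Ps" using assms(1) that by simp
    moreover have "?ss ! (t + 1) ! i = ?ss ! t ! i + 1 \<longleftrightarrow> i = ms ! t" if "i < length Ps" for i
      using Suc[OF \<open>t < length ms\<close> that] by simp
    ultimately show ?thesis by auto
  qed
  show "given_by_moves Ps (map (entries Ps) ?ss) (map (\<lambda>i. [i]) ms)"
    unfolding given_by_moves_def
  proof (intro exI conjI allI impI)
    show "index_tuples Ps ?ss" by (fact tup)
    fix t assume "t < length (map (\<lambda>i. [i]) ms)"
    then have t: "t < length ms" by simp
    then show "distinct (map (\<lambda>i. [i]) ms ! t)" by simp
    show "set (map (\<lambda>i. [i]) ms ! t) = {i. i < length Ps \<and> ?ss ! (t + 1) ! i = ?ss ! t ! i + 1}"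
      using move[OF t] by (simp only: nth_map[OF t])
  qed (simp_all add: len)
qed

lemma level_moves_le:
  assumes "processes Ps" "t \<le> length (moves Ps)"
  shows "level (int_paths Ps) (count_list (take t (moves Ps))) \<le> optimum Ps"
proof -
  let ?Qs = "int_paths Ps"
  let ?A = "expand (merged 1 ?Qs)" and ?B = "expand (merged 0 (map rev ?Qs))"
  have Ps: "Ps ! j \<noteq> []" if "j < length Ps" for j
    using assms(1) that by (auto simp: processes_def)
  show ?thesis
  proof (cases "t \<le> length ?A")
    case True
    have "level ?Qs (\<lambda>j. 0 + count_list (take t ?A) j) \<le> peak_of 1 ?Qs"
      unfolding peak_of_def using Ps
      by (intro level_expand_le_peak[where e = 1] merged(1)) (auto simp: merged(2) valid_blocks_blocks)
    then show ?thesis using True by (simp add: moves_def optimum_def)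
  next
    case False
    \<comment> \<open>Exactly \<open>k\<close> moves are still to come at time \<open>t\<close>; in
      reverse order they are the first \<open>k\<close> moves of \<open>?B\<close>. So the current
      state, seen in the reversed processes, is the one after \<open>take k ?B\<close>.\<close>
    define k where "k = length ?B - (t - length ?A)"
    have "level (map rev ?Qs) (\<lambda>j. 0 + count_list (take k ?B) j) \<le> peak_of 0 (map rev ?Qs)"
      unfolding peak_of_def using Ps
      by (intro level_expand_le_peak[where e = 0] merged(1)) (auto simp: merged(2) valid_blocks_blocks)
    moreover have "level (map rev ?Qs) (\<lambda>j. 0 + count_list (take k ?B) j) =
      level (map rev ?Qs) (\<lambda>j. length (?Qs ! j) - 1 - count_list (take t (moves Ps)) j)"
    proof (rule level_cong)
      fix j assume "j < length (map rev ?Qs)"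
      then have j: "j < length Ps" by simp
      have "take t (moves Ps) = ?A @ rev (drop k ?B)"
        using False assms(2) by (auto simp: moves_def k_def take_rev)
      moreover have "count_list (take k ?B) j + count_list (drop k ?B) j = count_list ?B j"
        by (metis append_take_drop_id count_list_append)
      moreover have "count_list ?A j + count_list ?B j = length (Ps ! j) - 1"
        using count_moves[OF assms(1) j] by (simp add: moves_def)
      ultimately show "0 + count_list (take k ?B) j =
          length (?Qs ! j) - 1 - count_list (take t (moves Ps)) j"
        using j by simp
    qed
    moreover have "\<dots> = level ?Qs (count_list (take t (moves Ps)))"
    proof (rule level_rev)
      fix j assume "j < length ?Qs"
      then have j: "j < length Ps" by simp
      have "count_list (take t (moves Ps)) j + count_list (drop t (moves Ps)) j = length (Ps ! j) - 1"
        by (metis append_take_drop_id count_list_append count_moves[OF assms(1) j])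
      then show "count_list (take t (moves Ps)) j < length (?Qs ! j)"
        using j Ps[OF j] by (cases "Ps ! j") auto
    qed
    ultimately show ?thesis by (simp add: optimum_def)
  qed
qed

theorem optimal_interleaving:
  assumes "processes Ps"
  defines "S \<equiv> map (entries Ps) (tuples_of (length Ps) (moves Ps))"
  shows "interleaving Ps S" "given_by_moves Ps S (map (\<lambda>i. [i]) (moves Ps))"
    and "sps S = spmin Ps" "int (spmin Ps) = optimum Ps"
proof -
  let ?ss = "tuples_of (length Ps) (moves Ps)"
  have ge: "optimum Ps \<le> int (sps S')" if "interleaving Ps S'" for S'
  proof -
    from that obtain ss where ss: "index_tuples Ps ss" "S' = map (entries Ps) ss"
      by (auto simp: interleaving_def)
    have "int (sum_list (entries Ps s)) \<le> int (sps S')" if "s \<in> set ss" for s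
      unfolding sps_def using that ss(2) by (auto intro: Max_ge)
    then show ?thesis
      using ex_ge_peak_of[OF assms(1) ss(1)] unfolding optimum_def by fastforce
  qed
  have tup: "index_tuples Ps ?ss" and giv: "given_by_moves Ps S (map (\<lambda>i. [i]) (moves Ps))"
    unfolding S_def
    using index_tuples_tuples_of[of "moves Ps" Ps] moves_less count_moves[OF assms(1)] by blast+
  show inter: "interleaving Ps S" unfolding interleaving_def S_def using tup by blast
  show "given_by_moves Ps S (map (\<lambda>i. [i]) (moves Ps))" by (fact giv)
  have "int (sum_list (entries Ps s)) \<le> optimum Ps" if "s \<in> set ?ss" for s
  proof -
    from that obtain t where t: "t \<le> length (moves Ps)"
      "s = map (count_list (take t (moves Ps))) [0..<length Ps]"
      by (auto simp: tuples_of_def less_Suc_eq_le simp del: upt_Suc map_eq_conv)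
    from that obtain t' where "t' < length ?ss" "?ss ! t' = s" by (auto simp: in_set_conv_nth)
    then have "s ! j < length (Ps ! j)" if "j < length Ps" for j
      using index_tuples_nth_le(2)[OF tup, of t' j] that assms(1)
      by (cases "Ps ! j") (auto simp: processes_def)
    then have "int (sum_list (entries Ps s)) = level (int_paths Ps) (\<lambda>j. s ! j)"
      by (rule sum_list_entries)
    also have "\<dots> = level (int_paths Ps) (count_list (take t (moves Ps)))"
      using t(2) by (intro level_cong) simp
    finally show ?thesis using level_moves_le[OF assms(1) t(1)] by simp
  qed
  moreover have "sps S \<in> sum_list ` set S"
    unfolding sps_def using tup by (intro Max_in) (auto simp: S_def index_tuples_def)
  ultimately have "int (sps S) \<le> optimum Ps" by (auto simp: S_def)
  with ge[OF inter] have eq: "int (sps S) = optimum Ps" by simp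
  have "spmin Ps = sps S"
    unfolding spmin_def using inter ge eq by (intro Least_equality) force+
  with eq show "sps S = spmin Ps" "int (spmin Ps) = optimum Ps" by simp_all
qed

section \<open>Merging\<close>

fun merge :: "block list \<Rightarrow> block list \<Rightarrow> block list" where
  "merge [] ys = ys"
| "merge (x # xs) [] = x # xs"
| "merge (x # xs) (y # ys) =
    (if fst x \<le> fst y then x # merge xs (y # ys) else y # merge (x # xs) ys)"

fun merge_pairs :: "block list list \<Rightarrow> block list list" where
  "merge_pairs [] = []"
| "merge_pairs [xs] = [xs]"
| "merge_pairs (xs # ys # Ls) = merge xs ys # merge_pairs Ls"

lemma length_merge_pairs: "length (merge_pairs Ls) = (length Ls + 1) div 2"
  by (induction Ls rule: merge_pairs.induct) auto

function merge_all :: "block list list \<Rightarrow> block list" where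
  "merge_all [] = []"
| "merge_all [xs] = xs"
| "merge_all (xs # ys # Ls) = merge_all (merge_pairs (xs # ys # Ls))"
  by pat_completeness auto
termination
  by (relation "measure length") (auto simp: length_merge_pairs)

lemma set_merge [simp]: "set (merge xs ys) = set xs \<union> set ys"
  by (induction xs ys rule: merge.induct) auto

lemma length_merge [simp]: "length (merge xs ys) = length xs + length ys"
  by (induction xs ys rule: merge.induct) auto

text \<open>As \<open>y\<close> is strictly smaller than all of \<open>xs\<close>, no tie is
  affected when it overtakes them.\<close>

lemma sort_key_append_Cons:
  "\<forall>x\<in>set xs. f y < f x \<Longrightarrow> sort_key f (xs @ y # ys) = insort_key f y (sort_key f (xs @ ys))"
  by (induction xs) (auto simp: insort_key_left_comm)

text \<open>Ties go to the left list, as in a stable sort. The exact equation identifies the output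
  of all merging rounds with \<open>merged\<close>, the list for which optimality is proved.\<close>

lemma merge_eq_sort_key:
  "sorted (map fst xs) \<Longrightarrow> sorted (map fst ys) \<Longrightarrow> merge xs ys = sort_key fst (xs @ ys)"
proof (induction xs ys rule: merge.induct)
  case (3 x xs y ys)
  show ?case
  proof (cases "fst x \<le> fst y")
    case True
    have "sort_key fst ((x # xs) @ y # ys) = insort_key fst x (merge xs (y # ys))"
      using 3 True by simp
    also have "\<dots> = x # merge xs (y # ys)"
      using 3 True by (intro insort_is_Cons) force
    finally show ?thesis using True by simp
  next
    case False
    have y: "sort_key fst ((x # xs) @ y # ys) = insort_key fst y (sort_key fst ((x # xs) @ ys))"
      using 3(3) False by (intro sort_key_append_Cons) auto
    have *: "fst y \<le> fst z" if z: "z \<in> set (merge (x # xs) ys)" for z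
    proof (cases "z \<in> set (x # xs)")
      case True
      with 3(3) have "fst x \<le> fst z" by auto
      with False show ?thesis by simp
    next
      case F: False
      with z have "z \<in> set ys" by simp
      with 3(4) show ?thesis by simp
    qed
    note y
    also have "insort_key fst y (sort_key fst ((x # xs) @ ys)) = insort_key fst y (merge (x # xs) ys)"
      using 3 False by simp
    also have "\<dots> = y # merge (x # xs) ys"
      using * by (intro insort_is_Cons) blast
    finally show ?thesis using False by simp
  qed
qed (auto simp: sort_key_id_if_sorted insort_is_Cons)

lemma sort_key_insort_append:
  "sort_key f (insort_key f x xs @ ys) = insort_key f x (sort_key f (xs @ ys))"
  by (induction xs) (auto simp: insort_key_left_comm)

lemma sort_key_append_sort_key:
  "sort_key f (sort_key f xs @ ys) = sort_key f (xs @ ys)"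
  "sort_key f (xs @ sort_key f ys) = sort_key f (xs @ ys)"
  by (induction xs) (auto simp: sort_key_insort_append sort_key_id_if_sorted)

lemma merge_pairs:
  assumes "\<forall>xs\<in>set Ls. sorted (map fst xs)"
  shows "\<forall>xs\<in>set (merge_pairs Ls). sorted (map fst xs)"
    and "sort_key fst (concat (merge_pairs Ls)) = sort_key fst (concat Ls)"
proof -
  have "(\<forall>xs\<in>set (merge_pairs Ls). sorted (map fst xs)) \<and>
    sort_key fst (concat (merge_pairs Ls)) = sort_key fst (concat Ls)"
    using assms
  proof (induction Ls rule: merge_pairs.induct)
    case (3 xs ys Ls)
    then have m: "merge xs ys = sort_key fst (xs @ ys)" by (simp add: merge_eq_sort_key)
    have IH: "sort_key fst (concat (merge_pairs Ls)) = sort_key fst (concat Ls)" using 3 by simp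
    have "sort_key fst ((xs @ ys) @ concat (merge_pairs Ls)) =
        sort_key fst ((xs @ ys) @ sort_key fst (concat (merge_pairs Ls)))"
      by (rule sort_key_append_sort_key(2)[symmetric])
    also have "\<dots> = sort_key fst ((xs @ ys) @ concat Ls)"
      unfolding IH by (rule sort_key_append_sort_key(2))
    finally have "sort_key fst (concat (merge_pairs (xs # ys # Ls))) = sort_key fst (concat (xs # ys # Ls))"
      unfolding merge_pairs.simps concat.simps m sort_key_append_sort_key(1) by simp
    then show ?case using 3 m by simp
  qed auto
  then show "\<forall>xs\<in>set (merge_pairs Ls). sorted (map fst xs)"
    "sort_key fst (concat (merge_pairs Ls)) = sort_key fst (concat Ls)" by blast+
qed

lemma merge_all:
  "\<forall>xs\<in>set Ls. sorted (map fst xs) \<Longrightarrow> merge_all Ls = sort_key fst (concat Ls)"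
  by (induction Ls rule: merge_all.induct)
    (simp_all add: sort_key_id_if_sorted merge_pairs del: merge_pairs.simps)

lemma length_concat_merge_pairs [simp]: "length (concat (merge_pairs Ls)) = length (concat Ls)"
  by (induction Ls rule: merge_pairs.induct) auto

section \<open>Timed evaluation\<close>

text \<open>Upper bounds in place of exact step counts let every rule just add the bounds of its
  parts; the sum is compared with a closed form once, through \<open>within_mono\<close>.\<close>

definition runs_within :: "program \<Rightarrow> val list \<Rightarrow> exp \<Rightarrow> val \<Rightarrow> nat \<Rightarrow> bool" where
  "runs_within p \<Gamma> e v b \<longleftrightarrow> (\<exists>t\<le>b. eval p \<Gamma> e v t)"

definition args_within :: "program \<Rightarrow> val list \<Rightarrow> exp list \<Rightarrow> val list \<Rightarrow> nat \<Rightarrow> bool" where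
  "args_within p \<Gamma> es vs b \<longleftrightarrow> (\<exists>t\<le>b. evals p \<Gamma> es vs t)"

definition lookup :: "val list \<Rightarrow> nat \<Rightarrow> val \<Rightarrow> bool" where
  "lookup \<Gamma> i v \<longleftrightarrow> i < length \<Gamma> \<and> \<Gamma> ! i = v"

text \<open>One rule per index lets resolution read entries off a concrete environment. The largest
  one has eight entries: the six arguments of \<open>absorb_exp\<close> plus head and tail.\<close>

lemma lookup_rules:
  "lookup (a # \<Gamma>) 0 a"
  "lookup (x0 # a # \<Gamma>) 1 a"
  "lookup (x0 # x1 # a # \<Gamma>) 2 a"
  "lookup (x0 # x1 # x2 # a # \<Gamma>) 3 a"
  "lookup (x0 # x1 # x2 # x3 # a # \<Gamma>) 4 a"
  "lookup (x0 # x1 # x2 # x3 # x4 # a # \<Gamma>) 5 a"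
  "lookup (x0 # x1 # x2 # x3 # x4 # x5 # a # \<Gamma>) 6 a"
  "lookup (x0 # x1 # x2 # x3 # x4 # x5 # x6 # a # \<Gamma>) 7 a"
  by (simp_all add: lookup_def)

definition Hd :: "exp \<Rightarrow> exp" where
  "Hd e = ECase e (EInt 0) (EVar 0)"

definition Tl :: "exp \<Rightarrow> exp" where
  "Tl e = ECase e ENil (EVar 1)"

lemma withinI: "eval p \<Gamma> e v t \<Longrightarrow> t \<le> b \<Longrightarrow> runs_within p \<Gamma> e v b"
  by (auto simp: runs_within_def)

lemma within_mono: "runs_within p \<Gamma> e v b \<Longrightarrow> v = v' \<and> b \<le> b' \<Longrightarrow> runs_within p \<Gamma> e v' b'"
  by (auto simp: runs_within_def intro: order_trans)

lemma within_Var: "lookup \<Gamma> i v \<Longrightarrow> runs_within p \<Gamma> (EVar i) v 1"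
  by (auto simp: lookup_def intro: withinI eval_evals.Var)

lemma within_Int: "runs_within p \<Gamma> (EInt k) (IntV k) 1"
  by (auto intro: withinI eval_evals.Int)

lemma within_Nil: "runs_within p \<Gamma> ENil (ListV []) 1"
  by (auto intro: withinI eval_evals.Nil)

lemma within_Cons:
  "runs_within p \<Gamma> e1 v b1 \<Longrightarrow> runs_within p \<Gamma> e2 (ListV vs) b2 \<Longrightarrow>
    runs_within p \<Gamma> (ECons e1 e2) (ListV (v # vs)) (b1 + b2 + 1)"
  unfolding runs_within_def by (meson add_le_mono eval_evals.Cons order_refl)

lemma within_arith:
  "runs_within p \<Gamma> e1 (IntV a) b1 \<Longrightarrow> runs_within p \<Gamma> e2 (IntV b) b2 \<Longrightarrow>
    runs_within p \<Gamma> (EArith f e1 e2) (IntV (arith_op f a b)) (b1 + b2 + 1)"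
  unfolding runs_within_def by (meson add_le_mono eval_evals.Arith order_refl)

lemmas within_Arith =
  within_arith[where f = Add, unfolded arith_op.simps]
  within_arith[where f = Sub, unfolded arith_op.simps]
  within_arith[where f = Maximum, unfolded arith_op.simps]

text \<open>The branch is selected by an \<open>if\<close> inside the last premise, so a single rule
  applies without search and simplification picks the branch; \<open>within_Case\<close> has the
  same form.\<close>

lemma within_If:
  assumes "runs_within p \<Gamma> e1 (IntV a) b1" "runs_within p \<Gamma> e2 (IntV b) b2"
    and "runs_within p \<Gamma> (if compare_op c a b then e3 else e4) v b3"
  shows "runs_within p \<Gamma> (EIf c e1 e2 e3 e4) v (b1 + b2 + b3 + 1)"
proof -
  obtain t1 t2 t3 where t: "eval p \<Gamma> e1 (IntV a) t1" "t1 \<le> b1" "eval p \<Gamma> e2 (IntV b) t2" "t2 \<le> b2"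
    "eval p \<Gamma> (if compare_op c a b then e3 else e4) v t3" "t3 \<le> b3"
    using assms unfolding runs_within_def by blast
  then have "eval p \<Gamma> (EIf c e1 e2 e3 e4) v (t1 + t2 + t3 + 1)"
    by (cases "compare_op c a b") (auto intro: eval_evals.IfTrue eval_evals.IfFalse simp del: One_nat_def)
  then show ?thesis using t by (intro withinI) auto
qed

lemma within_Case:
  assumes "runs_within p \<Gamma> e (ListV l) b1"
    and "runs_within p (if l = [] then \<Gamma> else hd l # ListV (tl l) # \<Gamma>) (if l = [] then e1 else e2) v b2"
  shows "runs_within p \<Gamma> (ECase e e1 e2) v (b1 + b2 + 1)"
proof -
  obtain t1 t2 where t: "eval p \<Gamma> e (ListV l) t1" "t1 \<le> b1"
    "eval p (if l = [] then \<Gamma> else hd l # ListV (tl l) # \<Gamma>) (if l = [] then e1 else e2) v t2" "t2 \<le> b2"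
    using assms unfolding runs_within_def by blast
  then have "eval p \<Gamma> (ECase e e1 e2) v (t1 + t2 + 1)"
    by (cases l) (auto intro: eval_evals.CaseNil eval_evals.CaseCons simp del: One_nat_def)
  then show ?thesis using t by (intro withinI) auto
qed

lemma within_Hd: "runs_within p \<Gamma> e (ListV (w # ws)) b \<Longrightarrow> runs_within p \<Gamma> (Hd e) w (b + 2)"
  unfolding Hd_def
  by (rule within_mono[OF within_Case[where ?b2.0 = 1]]) (auto intro: within_Var lookup_rules simp del: One_nat_def)

lemma within_Tl: "runs_within p \<Gamma> e (ListV (w # ws)) b \<Longrightarrow> runs_within p \<Gamma> (Tl e) (ListV ws) (b + 2)"
  unfolding Tl_def
  by (rule within_mono[OF within_Case[where ?b2.0 = 1]])
    (auto intro: within_Var lookup_rules simp del: One_nat_def)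

lemma within_Let:
  "runs_within p \<Gamma> e1 w b1 \<Longrightarrow> runs_within p (w # \<Gamma>) e2 v b2 \<Longrightarrow> runs_within p \<Gamma> (ELet e1 e2) v (b1 + b2 + 1)"
  unfolding runs_within_def by (meson add_le_mono eval_evals.Let order_refl)

lemma within_Call:
  "args_within p \<Gamma> es vs b1 \<Longrightarrow> f < length p \<Longrightarrow> runs_within p vs (p ! f) v b2 \<Longrightarrow>
    runs_within p \<Gamma> (ECall f es) v (b1 + b2 + 1)"
  unfolding runs_within_def args_within_def by (meson add_le_mono eval_evals.Call order_refl)

lemma args_within_Nil: "args_within p \<Gamma> [] [] 0"
  by (auto simp: args_within_def intro: eval_evals.ArgsNil)

lemma args_within_Cons:
  "runs_within p \<Gamma> e v b1 \<Longrightarrow> args_within p \<Gamma> es vs b2 \<Longrightarrow> args_within p \<Gamma> (e # es) (v # vs) (b1 + b2)"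
  unfolding runs_within_def args_within_def by (meson add_le_mono eval_evals.ArgsCons)

abbreviation (input) V :: "nat \<Rightarrow> exp" where "V \<equiv> EVar"

section \<open>The program\<close>

text \<open>The \<open>let\<close> belongs to HOL: \<open>rec\<close> is copied into both places of
  the syntax tree, so it shifts no variable index and costs no step.\<close>

definition absorb_exp :: exp where
  "absorb_exp = ECase (V 5)
    (EIf Less (V 3) (V 0) (ECons (ECons (V 2) (ECons (V 3) (ECons (V 1) (ECons (V 4) ENil)))) ENil) ENil)
    (let rec = ECall 1 [V 2, V 3, EArith Maximum (V 4) (EArith Add (V 5) (Hd (V 0))),
         EArith Add (V 5) (Hd (Tl (V 0))), EArith Add (V 6) (Hd (Tl (Tl (Tl (V 0))))), V 1]
     in EIf Less (V 5) (V 2)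
          (EIf Less (V 4) (Hd (V 0))
             (ECons (ECons (V 4) (ECons (V 5) (ECons (V 3) (ECons (V 6) ENil)))) (V 7)) rec)
          rec)"

definition blocks_exp :: exp where
  "blocks_exp = ECase (V 2) ENil (ECase (V 1) ENil
    (ECall 1 [V 4, V 5, EArith Maximum (EInt 0) (EArith Sub (V 0) (V 2)), EArith Sub (V 0) (V 2),
       EInt 1, ECall 2 [V 4, V 5, V 3]]))"

definition block_lists_exp :: exp where
  "block_lists_exp = ECase (V 2) ENil
    (ECons (ECall 2 [V 2, V 3, V 0]) (ECall 3 [V 2, EArith Add (EInt 1) (V 3), V 1]))"

definition merge_exp :: exp where
  "merge_exp = ECase (V 0) (V 1) (ECase (V 3) (V 2) (EIf LessEq (Hd (V 2)) (Hd (V 0))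
    (ECons (V 2) (ECall 4 [V 3, V 5])) (ECons (V 0) (ECall 4 [V 4, V 1]))))"

definition merge_pairs_exp :: exp where
  "merge_pairs_exp = ECase (V 0) ENil (ECase (V 1) (V 2) (ECons (ECall 4 [V 2, V 0]) (ECall 5 [V 1])))"

definition merge_all_exp :: exp where
  "merge_all_exp = ECase (V 0) ENil (ECase (V 1) (V 0) (ECall 6 [ECall 5 [V 4]]))"

definition rev_append_exp :: exp where
  "rev_append_exp = ECase (V 0) (V 1) (ECall 7 [V 1, ECons (V 0) (V 3)])"

definition map_rev_exp :: exp where
  "map_rev_exp = ECase (V 0) ENil (ECons (ECall 7 [V 0, ENil]) (ECall 8 [V 1]))"

definition sum_hd_exp :: exp where
  "sum_hd_exp = ECase (V 0) (EInt 0) (ECase (V 0) (EInt 0) (EArith Add (V 0) (ECall 9 [V 3])))"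

definition peak_exp :: exp where
  "peak_exp = ECase (V 1) (V 0) (EArith Maximum (EArith Add (V 2) (Hd (V 0)))
    (ECall 10 [EArith Add (V 2) (Hd (Tl (V 0))), V 1]))"

definition push_exp :: exp where
  "push_exp = EIf LessEq (V 1) (EInt 0) (V 2)
    (ECall 11 [V 0, EArith Sub (V 1) (EInt 1), ECons (ECons (V 0) ENil) (V 2)])"

definition push_all_exp :: exp where
  "push_all_exp = ECase (V 0) (V 1)
    (ECall 12 [V 1, ECall 11 [Hd (Tl (Tl (V 0))), Hd (Tl (Tl (Tl (V 0)))), V 3]])"

text \<open>\<open>push_all_exp\<close> prepends moves and thereby reverses their order. This is
  right for the second phase, which was found backwards in time; the blocks of the first phase are
  reversed beforehand by function 7.\<close>

definition main_exp :: exp where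
  "main_exp = ELet (ECall 8 [V 0])
    (ELet (ECall 6 [ECall 3 [EInt 1, EInt 0, V 1]])
    (ELet (ECall 6 [ECall 3 [EInt 0, EInt 0, V 1]])
    (ECons (EArith Maximum (ECall 10 [ECall 9 [V 3], V 1]) (ECall 10 [ECall 9 [V 2], V 0]))
    (ECons (ECall 12 [ECall 7 [V 1, ENil], ECall 12 [V 0, ENil]]) ENil))))"

definition schedule_prog :: program where
  "schedule_prog = [main_exp, absorb_exp, blocks_exp, block_lists_exp, merge_exp, merge_pairs_exp,
    merge_all_exp, rev_append_exp, map_rev_exp, sum_hd_exp, peak_exp, push_exp, push_all_exp]"

lemma schedule_prog_nth:
  "schedule_prog ! 0 = main_exp" "schedule_prog ! 1 = absorb_exp" "schedule_prog ! 2 = blocks_exp"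
  "schedule_prog ! 3 = block_lists_exp" "schedule_prog ! 4 = merge_exp" "schedule_prog ! 5 = merge_pairs_exp"
  "schedule_prog ! 6 = merge_all_exp" "schedule_prog ! 7 = rev_append_exp" "schedule_prog ! 8 = map_rev_exp"
  "schedule_prog ! 9 = sum_hd_exp" "schedule_prog ! 10 = peak_exp" "schedule_prog ! 11 = push_exp" "schedule_prog ! 12 = push_all_exp"
  by (simp_all add: schedule_prog_def)

lemma less_length_schedule_prog:
  "1 < length schedule_prog" "2 < length schedule_prog" "3 < length schedule_prog" "4 < length schedule_prog" "5 < length schedule_prog"
  "6 < length schedule_prog" "7 < length schedule_prog" "8 < length schedule_prog" "9 < length schedule_prog" "10 < length schedule_prog"
  "11 < length schedule_prog" "12 < length schedule_prog"
  by (simp_all add: schedule_prog_def)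

section \<open>Encoding of blocks and rules for symbolic execution\<close>

fun block_val :: "block \<Rightarrow> val" where
  "block_val (h, d, i, c) = ListV [IntV h, IntV d, IntV (int i), IntV (int c)]"

abbreviation "blocks_val bs \<equiv> ListV (map block_val bs)"

lemmas within_rules = lookup_rules within_Var within_Int within_Nil within_Cons within_Arith within_If
  within_Case within_Hd within_Tl within_Let within_Call args_within_Nil args_within_Cons less_length_schedule_prog

lemma hd_tl_map: "hd (map f (x # xs)) = f x" "tl (map f (x # xs)) = map f xs"
  by simp_all

lemma map_Cons_neq_Nil: "(map f (x # xs) = []) = False" "(map f [] = []) = True"
  by simp_all

text \<open>Programs are executed symbolically: \<open>within_rules\<close> is syntax-directed, and \<open>exec\<close> decides
  branches. It must not unfold \<open>map\<close> on a whole argument list, so that call arguments still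
  match the induction hypotheses.\<close>

lemmas exec = if_True if_False hd_tl_map map_Cons_neq_Nil block_val.simps compare_op.simps Let_def
  list.sel list.distinct

text \<open>This keeps the natural-number subtraction in the time bounds for \<open>absorb\<close>
  and \<open>blocks\<close> from being cut off at 0.\<close>

lemma length_absorb: "length (absorb e i h d c bs) \<le> length bs + 1"
  by (induction e i h d c bs rule: absorb.induct) auto

text \<open>The subtracted term is the potential that pays for later absorptions.\<close>

lemma within_absorb:
  "runs_within schedule_prog [IntV e, IntV (int i), IntV h, IntV d, IntV (int c), blocks_val bs] (schedule_prog ! 1)
    (blocks_val (absorb e i h d c bs)) (60 * (length bs + 2) - 60 * length (absorb e i h d c bs))"
proof (induction e i h d c bs rule: absorb.induct)
  case (1 e i h d c)
  show ?case
  proof (cases "d < e")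
    case True
    show ?thesis unfolding schedule_prog_nth absorb_exp_def
      apply (rule within_mono)
       apply (rule within_rules | simp only: exec True)+
      using True by simp
  next
    case False
    show ?thesis unfolding schedule_prog_nth absorb_exp_def
      apply (rule within_mono)
       apply (rule within_rules | simp only: exec False)+
      using False by simp
  qed
next
  case (2 e i h d c h' d' i' c' bs)
  consider "d < e" "h < h'" | "d < e" "\<not> h < h'" | "\<not> d < e" by blast
  then show ?case
  proof cases
    case 1
    show ?thesis unfolding schedule_prog_nth absorb_exp_def
      apply (rule within_mono)
       apply (rule within_rules | simp only: exec 1)+
      using 1 by simp
  next
    case 22: 2
    then have F: "\<not> (d < e \<and> h < h')" by simp
    note IH = 2[OF F, unfolded of_nat_add]
    show ?thesis unfolding schedule_prog_nth absorb_exp_def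
      apply (rule within_mono)
       apply (rule within_rules IH | simp only: exec 22)+
      using 22 length_absorb[of e i "max h (d + h')" "d + d'" "c + c'" bs] by simp
  next
    case 3
    then have F: "\<not> (d < e \<and> h < h')" by simp
    note IH = 2[OF F, unfolded of_nat_add]
    show ?thesis unfolding schedule_prog_nth absorb_exp_def
      apply (rule within_mono)
       apply (rule within_rules IH | simp only: exec 3)+
      using 3 length_absorb[of e i "max h (d + h')" "d + d'" "c + c'" bs] by simp
  qed
qed

section \<open>Time to compute the block lists\<close>

abbreviation "paths_val Qs \<equiv> ListV (map (\<lambda>Q. ListV (map IntV Q)) Qs)"

abbreviation "block_lists_val Ls \<equiv> ListV (map (\<lambda>bs. blocks_val bs) Ls)"

abbreviation "move_val i \<equiv> ListV [IntV (int i)]"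

lemma length_blocks: "length (blocks e i Q) \<le> length Q"
  by (induction e i Q rule: blocks.induct) (auto intro: order_trans[OF length_absorb])

text \<open>A single call of \<open>absorb\<close> may consume many blocks, but the 60 steps per
  block saved in the bound for the tail cancel the term \<open>60 * length bs\<close> of that call.
  Of the 200 steps per position, 120 remain for \<open>absorb\<close> and the rest pays for the
  surrounding code.\<close>

lemma within_blocks:
  "runs_within schedule_prog [IntV e, IntV (int i), ListV (map IntV Q)] (schedule_prog ! 2)
    (blocks_val (blocks e i Q)) (200 * length Q + 10 - 60 * length (blocks e i Q))"
proof (induction e i Q rule: blocks.induct)
  case (1 e i)
  show ?case unfolding schedule_prog_nth blocks_exp_def
    apply (rule within_mono)
     apply (rule within_rules | simp only: exec)+
    by simp
next
  case (2 e i p)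
  show ?case unfolding schedule_prog_nth blocks_exp_def
    apply (rule within_mono)
     apply (rule within_rules | simp only: exec)+
    by simp
next
  case (3 e i p q ps)
  show ?case unfolding schedule_prog_nth blocks_exp_def
    apply (rule within_mono)
     apply (rule within_rules 3 within_absorb[where c = 1, unfolded of_nat_1] | simp only: exec)+
    using length_blocks[of e i "q # ps"]
      length_absorb[of e i "max 0 (q - p)" "q - p" 1 "blocks e i (q # ps)"]
    by simp
qed

lemma within_block_lists:
  "runs_within schedule_prog [IntV e, IntV (int k), paths_val Qs] (schedule_prog ! 3)
    (block_lists_val (block_lists e k Qs)) (200 * length (concat Qs) + 60 * length Qs + 10)"
proof (induction e k Qs rule: block_lists.induct)
  case (1 e k)
  show ?case unfolding schedule_prog_nth block_lists_exp_def
    apply (rule within_mono)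
     apply (rule within_rules | simp only: exec)+
    by simp
next
  case (2 e k Q Qs)
  show ?case unfolding schedule_prog_nth block_lists_exp_def
    apply (rule within_mono)
     apply (rule within_rules within_blocks 2[unfolded of_nat_Suc] | simp only: exec)+
    by simp
qed

section \<open>Time to merge the block lists\<close>

lemma within_merge:
  "runs_within schedule_prog [blocks_val xs, blocks_val ys] (schedule_prog ! 4)
    (blocks_val (merge xs ys)) (50 * (length xs + length ys) + 20)"
proof (induction xs ys rule: merge.induct)
  case (1 ys)
  show ?case unfolding schedule_prog_nth merge_exp_def
    apply (rule within_mono)
     apply (rule within_rules | simp only: exec)+
    by simp
next
  case (2 x xs)
  show ?case unfolding schedule_prog_nth merge_exp_def
    apply (rule within_mono)
     apply (rule within_rules | simp only: exec)+
    by simp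
next
  case (3 x xs y ys)
  obtain h d i c h' d' i' c' where x: "x = (h, d, i, c)" and y: "y = (h', d', i', c')"
    by (cases x, cases y)
  show ?case
  proof (cases "h \<le> h'")
    case True
    then have "fst x \<le> fst y" by (simp add: x y)
    note IH = 3(1)[OF this, unfolded x y]
    show ?thesis unfolding schedule_prog_nth merge_exp_def x y
      apply (rule within_mono)
       apply (rule within_rules IH | simp only: exec True)+
      using True by simp
  next
    case False
    then have "\<not> fst x \<le> fst y" by (simp add: x y)
    note IH = 3(2)[OF this, unfolded x y]
    show ?thesis unfolding schedule_prog_nth merge_exp_def x y
      apply (rule within_mono)
       apply (rule within_rules IH | simp only: exec False)+
      using False by simp
  qed
qed

lemma within_merge_pairs:
  "runs_within schedule_prog [block_lists_val Ls] (schedule_prog ! 5)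
    (block_lists_val (merge_pairs Ls)) (50 * length (concat Ls) + 60 * length Ls + 20)"
proof (induction Ls rule: merge_pairs.induct)
  case 1
  show ?case unfolding schedule_prog_nth merge_pairs_exp_def
    apply (rule within_mono)
     apply (rule within_rules | simp only: exec)+
    by simp
next
  case (2 xs)
  show ?case unfolding schedule_prog_nth merge_pairs_exp_def
    apply (rule within_mono)
     apply (rule within_rules | simp only: exec)+
    by simp
next
  case (3 xs ys Ls)
  show ?case unfolding schedule_prog_nth merge_pairs_exp_def
    apply (rule within_mono)
     apply (rule within_rules within_merge 3 | simp only: exec)+
    by simp
qed

text \<open>A round halves the number of lists, rounding up, and keeps their total length, so
  \<open>k\<close> bounds the number of rounds and each round is linear.\<close>

lemma within_merge_all:
  "length Ls \<le> 2 ^ k \<Longrightarrow> runs_within schedule_prog [block_lists_val Ls] (schedule_prog ! 6)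
    (blocks_val (merge_all Ls)) (k * (50 * length (concat Ls) + 60 * length Ls + 60) + 20)"
proof (induction Ls arbitrary: k rule: merge_all.induct)
  case 1
  show ?case unfolding schedule_prog_nth merge_all_exp_def
    apply (rule within_mono)
     apply (rule within_rules | simp only: exec)+
    by simp
next
  case (2 xs)
  show ?case unfolding schedule_prog_nth merge_all_exp_def
    apply (rule within_mono)
     apply (rule within_rules | simp only: exec)+
    by simp
next
  case (3 xs ys Ls)
  let ?Ls = "xs # ys # Ls"
  from 3(2) obtain k' where k: "k = Suc k'" by (cases k) auto
  have "length (merge_pairs ?Ls) \<le> 2 ^ k'"
    using 3(2) unfolding length_merge_pairs k by simp
  note IH = 3(1)[OF this]
  have "k' * (50 * length (concat (merge_pairs ?Ls)) + 60 * length (merge_pairs ?Ls) + 60)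
      \<le> k' * (50 * length (concat ?Ls) + 60 * length ?Ls + 60)"
    unfolding length_concat_merge_pairs length_merge_pairs by (intro mult_le_mono2) simp
  moreover have "k * (50 * length (concat ?Ls) + 60 * length ?Ls + 60) =
      50 * length (concat ?Ls) + 60 * length ?Ls + 60 +
      k' * (50 * length (concat ?Ls) + 60 * length ?Ls + 60)"
    unfolding k by simp
  ultimately show ?case unfolding schedule_prog_nth merge_all_exp_def
    apply -
    apply (rule within_mono)
     apply (rule within_rules within_merge_pairs IH | simp only: exec)+
    apply (intro conjI)
     apply (simp only: merge_all.simps)
    apply linarith
    done
qed

section \<open>Time for reversal, peaks and output\<close>

lemma within_rev_append:
  "runs_within schedule_prog [ListV xs, ListV ys] (schedule_prog ! 7) (ListV (rev xs @ ys)) (20 * length xs + 10)"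
proof (induction xs arbitrary: ys)
  case Nil
  show ?case unfolding schedule_prog_nth rev_append_exp_def
    apply (rule within_mono)
     apply (rule within_rules | simp only: exec simp_thms)+
    by simp
next
  case (Cons x xs)
  show ?case unfolding schedule_prog_nth rev_append_exp_def
    apply (rule within_mono)
     apply (rule within_rules Cons | simp only: exec)+
    by simp
qed

lemma within_map_rev:
  "runs_within schedule_prog [paths_val Qs] (schedule_prog ! 8) (paths_val (map rev Qs))
    (20 * length (concat Qs) + 60 * length Qs + 10)"
proof (induction Qs)
  case Nil
  show ?case unfolding schedule_prog_nth map_rev_exp_def
    apply (rule within_mono)
     apply (rule within_rules | simp only: exec)+
    by simp
next
  case (Cons Q Qs)
  show ?case unfolding schedule_prog_nth map_rev_exp_def
    apply (rule within_mono)
     apply (rule within_rules within_rev_append Cons | simp only: exec)+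
    by (simp add: rev_map)
qed

lemma within_sum_hd:
  "\<forall>Q\<in>set Qs. Q \<noteq> [] \<Longrightarrow> runs_within schedule_prog [paths_val Qs] (schedule_prog ! 9)
    (IntV (\<Sum>Q\<leftarrow>Qs. hd Q)) (30 * length Qs + 10)"
proof (induction Qs)
  case Nil
  show ?case unfolding schedule_prog_nth sum_hd_exp_def
    apply (rule within_mono)
     apply (rule within_rules | simp only: exec)+
    by simp
next
  case (Cons Q Qs)
  from Cons.prems obtain q qs where Q: "Q = q # qs" by (cases Q) auto
  from Cons have IH: "runs_within schedule_prog [paths_val Qs] (schedule_prog ! 9) (IntV (\<Sum>Q\<leftarrow>Qs. hd Q)) (30 * length Qs + 10)"
    by simp
  show ?case unfolding schedule_prog_nth sum_hd_exp_def Q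
    apply (rule within_mono)
     apply (rule within_rules IH | simp only: exec)+
    by simp
qed

lemma within_peak:
  "runs_within schedule_prog [IntV T, blocks_val M] (schedule_prog ! 10) (IntV (peak T M)) (40 * length M + 10)"
proof (induction T M rule: peak.induct)
  case (1 T)
  show ?case unfolding schedule_prog_nth peak_exp_def
    apply (rule within_mono)
     apply (rule within_rules | simp only: exec)+
    by simp
next
  case (2 T h d i c M)
  show ?case unfolding schedule_prog_nth peak_exp_def
    apply (rule within_mono)
     apply (rule within_rules 2 | simp only: exec)+
    by simp
qed

lemma within_push:
  "runs_within schedule_prog [IntV (int i), IntV (int c), ListV vs] (schedule_prog ! 11)
    (ListV (replicate c (move_val i) @ vs)) (30 * c + 10)"
proof (induction c arbitrary: vs)
  case 0
  have c: "(int 0 \<le> 0) = True" by simp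
  show ?case unfolding schedule_prog_nth push_exp_def
    apply (rule within_mono)
     apply (rule within_rules | simp only: exec c)+
    by simp
next
  case (Suc c)
  have c: "(int (Suc c) \<le> 0) = False" "int (Suc c) - 1 = int c" by simp_all
  show ?case unfolding schedule_prog_nth push_exp_def
    apply (rule within_mono)
     apply (rule within_rules Suc | simp only: exec c)+
    by (simp add: replicate_app_Cons_same)
qed

lemma expand_simps [simp]: "expand [] = []" "expand ((h, d, i, c) # M) = replicate c i @ expand M"
  by (simp_all add: expand_def)

text \<open>A block expands to copies of one index, so only the order of the blocks matters.\<close>

lemma rev_expand_rev: "rev (expand (rev M)) = expand M"
  by (simp add: expand_def rev_concat rev_map o_def)

lemma within_push_all:
  "runs_within schedule_prog [blocks_val M, ListV vs] (schedule_prog ! 12)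
    (ListV (map move_val (rev (expand M)) @ vs)) (60 * length M + 30 * length (expand M) + 10)"
proof (induction M arbitrary: vs)
  case Nil
  show ?case unfolding schedule_prog_nth push_all_exp_def
    apply (rule within_mono)
     apply (rule within_rules | simp only: exec)+
    by simp
next
  case (Cons b M)
  obtain h d i c where b: "b = (h, d, i, c)" by (cases b)
  show ?case unfolding schedule_prog_nth push_all_exp_def b
    apply (rule within_mono)
     apply (rule within_rules within_push Cons | simp only: exec)+
    by simp
qed

section \<open>Time of the whole program\<close>

lemma length_block_lists [simp]: "length (block_lists e k Qs) = length Qs"
  by (induction e k Qs rule: block_lists.induct) auto

lemma length_concat_block_lists: "length (concat (block_lists e k Qs)) \<le> length (concat Qs)"
  by (induction e k Qs rule: block_lists.induct) (auto intro: add_mono length_blocks)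

lemma merge_all_block_lists: "merge_all (block_lists e 0 Qs) = merged e Qs"
proof -
  have "\<forall>bs\<in>set (block_lists e k Qs). sorted (map fst bs)" for k
    by (induction e k Qs rule: block_lists.induct) (auto simp: sorted_blocks)
  then show ?thesis by (simp add: merge_all merged_def)
qed

lemma length_merged: "length (merged e Qs) \<le> length (concat Qs)"
  unfolding merged_def length_sort by (rule length_concat_block_lists)

lemma within_merged:
  assumes "length Qs \<le> 2 ^ k"
  shows "runs_within schedule_prog [block_lists_val (block_lists e 0 Qs)] (schedule_prog ! 6) (blocks_val (merged e Qs))
    (k * (50 * length (concat Qs) + 60 * length Qs + 60) + 20)"
proof (rule within_mono[OF within_merge_all])
  show "length (block_lists e 0 Qs) \<le> 2 ^ k" using assms by simp
  show "blocks_val (merge_all (block_lists e 0 Qs)) = blocks_val (merged e Qs) \<and>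
    k * (50 * length (concat (block_lists e 0 Qs)) + 60 * length (block_lists e 0 Qs) + 60) + 20
    \<le> k * (50 * length (concat Qs) + 60 * length Qs + 60) + 20"
    using length_concat_block_lists[of e 0 Qs]
    by (simp add: merge_all_block_lists)
qed

text \<open>The number of moves appears as a term of its own because a block stores its length as a
  number, which the output spells out move by move.\<close>

lemma within_main:
  assumes "length Qs \<le> 2 ^ k" "\<forall>Q\<in>set Qs. Q \<noteq> []"
  defines "A \<equiv> merged 1 Qs" and "B \<equiv> merged 0 (map rev Qs)"
  shows "runs_within schedule_prog [paths_val Qs] (schedule_prog ! 0)
    (ListV [IntV (max (peak (\<Sum>Q\<leftarrow>Qs. hd Q) A) (peak (\<Sum>Q\<leftarrow>map rev Qs. hd Q) B)),
      ListV (map move_val (expand A @ rev (expand B)))])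
    (1000 * (length (concat Qs) + length Qs + length (expand A @ rev (expand B)) + 1) +
      2 * (k * (50 * length (concat Qs) + 60 * length Qs + 60)))"
proof -
  have len: "length (concat (map rev Qs)) = length (concat Qs)"
    by (induction Qs) auto
  have lenAB: "length A \<le> length (concat Qs)" "length B \<le> length (concat Qs)"
    using length_merged[of 1 Qs] length_merged[of 0 "map rev Qs"] len by (simp_all add: A_def B_def)
  have lenE: "length (expand (rev A)) = length (expand A)"
    by (metis length_rev rev_expand_rev)
  note mA = within_merged[OF assms(1), of 1, folded A_def]
  have mB: "runs_within schedule_prog [block_lists_val (block_lists 0 0 (map rev Qs))] (schedule_prog ! 6) (blocks_val B)
      (k * (50 * length (concat Qs) + 60 * length Qs + 60) + 20)"
    using within_merged[of "map rev Qs" k 0] assms(1) unfolding len B_def by simp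
  have hdB: "runs_within schedule_prog [paths_val (map rev Qs)] (schedule_prog ! 9)
      (IntV (\<Sum>Q\<leftarrow>map rev Qs. hd Q)) (30 * length (map rev Qs) + 10)"
    using assms(2) by (intro within_sum_hd) auto
  \<comment> \<open>The reversing function yields a list of encoded blocks with \<open>[]\<close>
    appended; this brings it into the form \<open>blocks_val\<close> that
    \<open>within_push_all\<close> expects.\<close>
  have rev: "rev (map block_val A) @ [] = map block_val (rev A)" by (simp add: rev_map)
  note rules = within_map_rev within_block_lists[where k = 0, unfolded of_nat_0] mA mB
    within_sum_hd[OF assms(2)] hdB within_peak within_rev_append within_push_all
  show ?thesis unfolding schedule_prog_nth main_exp_def
    apply (rule within_mono)
     apply (rule within_rules rules | simp only: exec rev)+
    using lenAB by (simp add: rev_expand_rev lenE len)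
qed

section \<open>From step counts to the logarithmic bound\<close>

lemma level_zero:
  assumes "\<forall>Q\<in>set Qs. Q \<noteq> []"
  shows "level Qs (\<lambda>j. 0) = (\<Sum>Q\<leftarrow>Qs. hd Q)"
  unfolding level_def sum_list_sum_nth using assms
  by (auto simp: hd_conv_nth atLeast0LessThan intro!: sum.cong)

lemma length_concat_int_paths: "length (concat (int_paths Ps)) = total_size Ps"
  by (simp add: int_paths_def total_size_def length_concat o_def)

lemma length_moves_le:
  assumes "processes Ps"
  shows "length (moves Ps) \<le> total_size Ps"
proof -
  have "length (moves Ps) = (\<Sum>j<length Ps. count_list (moves Ps) j)"
    by (rule sum_count_set[symmetric]) (auto dest: moves_less)
  also have "\<dots> \<le> (\<Sum>j<length Ps. length (Ps ! j))"
    by (intro sum_mono) (simp add: count_moves[OF assms])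
  also have "\<dots> = total_size Ps"
    by (simp add: total_size_def sum_list_sum_nth atLeast0LessThan)
  finally show ?thesis .
qed

lemma length_le_total_size:
  assumes "processes Ps"
  shows "length Ps \<le> total_size Ps"
proof -
  have "(\<Sum>P\<leftarrow>Ps. 1) \<le> total_size Ps"
    unfolding total_size_def using assms
    by (intro sum_list_mono) (auto simp: processes_def Suc_le_eq)
  then show ?thesis by (simp add: sum_list_triv)
qed

lemma log_of_ge_1: "N \<ge> 1 \<Longrightarrow> 1 \<le> log_of N"
  by (simp add: log_of_def)

text \<open>Rounding the logarithm up adds at most 1, which the factor 2 absorbs since
  \<open>log_of N\<close> is at least 1; for \<open>N = 1\<close> no merging round takes
  place.\<close>

lemma ex_power_two_ge:
  assumes "N \<ge> 1"
  obtains k where "N \<le> 2 ^ k" "real k \<le> 2 * log_of N"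
proof (cases "N = 1")
  case True
  then show ?thesis using that[of 0] by (simp add: log_of_def)
next
  case False
  define k where "k = nat \<lceil>log 2 (real N)\<rceil>"
  have ge: "1 \<le> log 2 (real N)" using False assms by simp
  then have k: "log 2 (real N) \<le> real k" "real k \<le> log 2 (real N) + 1"
    unfolding k_def by linarith+
  have "real N \<le> 2 ^ k"
    using k(1) assms by (simp add: log_le_iff powr_realpow)
  then have "N \<le> 2 ^ k" by (metis of_nat_le_iff of_nat_numeral of_nat_power)
  then show ?thesis using that k(2) ge False by (simp add: log_of_def)
qed

lemma nat_lists_val_eq: "nat_lists_val Ps = paths_val (int_paths Ps)"
  by (simp add: nat_lists_val_def int_paths_def nat_val_def)

theorem theorem5p6:
  "\<exists>(p :: program) (C :: real). \<forall>Ps :: process list. \<forall>N n :: nat.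
     processes Ps \<and> N = length Ps \<and> n = total_size Ps \<longrightarrow>
     (\<exists>S Ds t.
        computes_in p (nat_lists_val Ps) (ListV [nat_val (spmin Ps), nat_lists_val Ds]) t \<and>
        interleaving Ps S \<and> given_by_moves Ps S Ds \<and> sps S = spmin Ps \<and>
        real t \<le> C * (real N * log_of N + real n * log_of N))"
proof (intro exI[of _ schedule_prog] exI[of _ 5000] allI impI, elim conjE)
  fix Ps :: "process list" and N n :: nat
  assume Ps: "processes Ps" and N: "N = length Ps" and n: "n = total_size Ps"
  define S where "S = map (entries Ps) (tuples_of (length Ps) (moves Ps))"
  define Ds where "Ds = map (\<lambda>i. [i]) (moves Ps)"
  note opt = optimal_interleaving[OF Ps, folded S_def Ds_def]
  have N1: "1 \<le> N" "N \<le> n"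
    using Ps length_le_total_size[OF Ps] by (auto simp: N n processes_def Suc_le_eq)
  obtain k where k: "N \<le> 2 ^ k" "real k \<le> 2 * log_of N"
    using ex_power_two_ge[OF N1(1)] by blast
  let ?Qs = "int_paths Ps"
  have ne: "\<forall>Q\<in>set ?Qs. Q \<noteq> []" "\<forall>Q\<in>set (map rev ?Qs). Q \<noteq> []"
    using Ps by (auto simp: int_paths_def processes_def)
  have "max (peak (\<Sum>Q\<leftarrow>?Qs. hd Q) (merged 1 ?Qs))
      (peak (\<Sum>Q\<leftarrow>map rev ?Qs. hd Q) (merged 0 (map rev ?Qs))) = int (spmin Ps)"
    unfolding level_zero[OF ne(1), symmetric] level_zero[OF ne(2), symmetric] opt(4)
    by (simp only: optimum_def peak_of_def)
  moreover have "ListV (map move_val (moves Ps)) = nat_lists_val Ds"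
    by (simp add: Ds_def nat_lists_val_def nat_val_def)
  moreover have "length ?Qs \<le> 2 ^ k" using k(1) N by simp
  ultimately have "runs_within schedule_prog [nat_lists_val Ps] (schedule_prog ! 0)
      (ListV [nat_val (spmin Ps), nat_lists_val Ds])
      (1000 * (n + N + length (moves Ps) + 1) + 2 * (k * (50 * n + 60 * N + 60)))"
    using within_main[of ?Qs k] ne(1)
    unfolding nat_lists_val_eq[of Ps] moves_def[symmetric] nat_val_def length_concat_int_paths
    by (simp add: N n)
  then obtain t where t: "eval schedule_prog [nat_lists_val Ps] (schedule_prog ! 0)
      (ListV [nat_val (spmin Ps), nat_lists_val Ds]) t"
    "t \<le> 1000 * (n + N + length (moves Ps) + 1) + 2 * (k * (50 * n + 60 * N + 60))"
    unfolding runs_within_def by blast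
  \<comment> \<open>Processes are nonempty, so \<open>N\<close>, the number of moves and 1 are all
    at most \<open>n\<close>: this gives 4000, and 50 + 60 + 60 = 170 below.\<close>
  have "1000 * (n + N + length (moves Ps) + 1) \<le> 4000 * n"
    using N1 length_moves_le[OF Ps, folded n] by simp
  moreover have "k * (50 * n + 60 * N + 60) \<le> k * (170 * n)"
    using N1 by (intro mult_le_mono2) simp
  then have "2 * (k * (50 * n + 60 * N + 60)) \<le> 340 * (k * n)"
    by (simp only: mult.left_commute[of k])
  ultimately have "t \<le> 4000 * n + 340 * (k * n)"
    by (rule order_trans[OF t(2) add_mono])
  then have "real t \<le> real (4000 * n + 340 * (k * n))"
    by (rule of_nat_mono)
  also have "\<dots> = 4000 * real n + 340 * (real k * real n)" by simp
  also have "\<dots> \<le> 4000 * (log_of N * real n) + 340 * ((2 * log_of N) * real n)"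
    using mult_right_mono[OF log_of_ge_1[OF N1(1)], of "real n"]
      mult_right_mono[OF k(2), of "real n"] by simp
  \<comment> \<open>The coefficient of \<open>log_of N * real n\<close> is 4000 + 2 * 340 = 4680, so
    5000 is a rounded constant.\<close>
  also have "\<dots> \<le> 5000 * (real N * log_of N + real n * log_of N)"
  proof -
    have "0 \<le> log_of N * real n" "0 \<le> log_of N * real N"
      using log_of_ge_1[OF N1(1)] by simp_all
    then show ?thesis by (simp add: algebra_simps)
  qed
  finally have "real t \<le> 5000 * (real N * log_of N + real n * log_of N)" .
  moreover have "computes_in schedule_prog (nat_lists_val Ps) (ListV [nat_val (spmin Ps), nat_lists_val Ds]) t"
    unfolding computes_in_def using t(1) by (intro conjI) (simp add: schedule_prog_def, assumption)
  ultimately show "\<exists>S Ds t.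
        computes_in schedule_prog (nat_lists_val Ps) (ListV [nat_val (spmin Ps), nat_lists_val Ds]) t \<and>
        interleaving Ps S \<and> given_by_moves Ps S Ds \<and> sps S = spmin Ps \<and>
        real t \<le> 5000 * (real N * log_of N + real n * log_of N)"
    using opt(1-3) by blast
qed

end
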